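(* Let $A_\bullet$ be a filtered abelian group and $\mathrm{HK}(A_\bullet)$ its Host–Kra cubegroup. Then the simplicial abelian group $K^\ast\mathrm{HK}(A_\bullet)$ corresponds, under the Dold–Kan correspondence, to a connective chain complex isomorphic to $$\cdots\longrightarrow A_3^2\xrightarrow{(a,b)\mapsto(b,0)}A_2^2\xrightarrow{(a,b)\mapsto(b,0)}A_1^2\xrightarrow{(a,b)\mapsto b}A_0,$$ with $A_0$ in degree $0$ and $A_n^2=A_n\oplus A_n$ in degree $n\ge1$.
   Context: A filtered abelian group $A_\bullet$ is a descending chain of abelian groups $A_0\supseteq A_1\supseteq A_2\supseteq\cdots$. Its Host–Kra cubegroup $\mathrm{HK}(A_\bullet)$ is the concrete cubeset whose $n$-cubes are the maps $c\colon\{0,1\}^n\to A_0$ of the form $c(x)=\sum_{S\subseteq\{0,\dots,n-1\}}a_S\prod_{i\in S}x_i$ with $a_S\in A_{|S|}$; it is an abelian group object under pointwise addition. The category $\square$ has objects $\{0,1\}^n$, $n\ge 0$, and morphisms the maps $\{0,1\}^n\to\{0,1\}^m$ that are restrictions of affine linear maps $\mathbb Z^n\to\mathbb Z^m$. A cubeset is a presheaf of sets on $\square$. $\mathrm{Sub}[n]$ denotes the set of nonempty subsets of $\{0,\dots,n\}$; $\Delta$ is the simplex category; $\sigma\colon[k]\to[n]$ in $\Delta$ induces $\sigma_\ast\colon\mathrm{Sub}[k]\to\mathrm{Sub}[n]$ by direct image. A formal $k$-cube with labels in $[k]$ is a map $A\colon\{0,1\}^k\to\mathrm{Sub}[k]$.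 It is degenerable if for every $0\le i<k$, $\sigma_{i,\ast}\circ A$ does not depend on the coordinate $x_i$, where $\sigma_i\colon[k]\to[k-1]$ is the degeneracy identifying $i$ and $i+1$ (coordinates are $x_0,\dots,x_{k-1}$). Let $K_n(m)$ be the set of all composites $\sigma_\ast\circ A\circ\phi\colon\{0,1\}^m\to\mathrm{Sub}[n]$ with $\phi\colon\{0,1\}^m\to\{0,1\}^k$ in $\square$, $A$ a degenerable formal $k$-cube, $\sigma\colon[k]\to[n]$ in $\Delta$, $k\ge0$; this is a cosimplicial cubeset. For a cubeset $X$, $K^\ast X$ is the simplicial set $[n]\mapsto\mathrm{Hom}(K_n,X)$ (Hom of cubesets). For an abelian group object $X$ this is a simplicial abelian group. The Dold–Kan correspondence sends a simplicial abelian group to its normalized Moore complex. *)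

theory Defs
  imports "HOL-Algebra.FiniteProduct"
begin

section \<open>The category of discrete cubes and cubesets\<close>

definition cube :: "nat \<Rightarrow> (nat \<Rightarrow> int) set" where
  "cube n = {..<n} \<rightarrow>\<^sub>E {0, 1}"

definition box_hom :: "nat \<Rightarrow> nat \<Rightarrow> ((nat \<Rightarrow> int) \<Rightarrow> nat \<Rightarrow> int) set" where
  "box_hom m n = {\<phi> \<in> cube m \<rightarrow>\<^sub>E cube n.
     \<exists>(M :: nat \<Rightarrow> nat \<Rightarrow> int) b. \<forall>x \<in> cube m. \<forall>j<n. \<phi> x j = b j + (\<Sum>i<m. M j i * x i)}"

text \<open>The contravariant action of a morphism \<^term>\<open>\<phi> \<in> box_hom m n\<close> on a presheaf \<open>X\<close> is
  \<open>restr X m n \<phi>\<close>, from \<open>cells X n\<close> to \<open>cells X m\<close>.\<close>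

record 'c cubeset =
  cells :: "nat \<Rightarrow> 'c set"
  restr :: "nat \<Rightarrow> nat \<Rightarrow> ((nat \<Rightarrow> int) \<Rightarrow> nat \<Rightarrow> int) \<Rightarrow> 'c \<Rightarrow> 'c"

definition is_cubeset :: "('c, 'z) cubeset_scheme \<Rightarrow> bool" where
  "is_cubeset X \<longleftrightarrow>
     (\<forall>m n. \<forall>\<phi> \<in> box_hom m n. restr X m n \<phi> \<in> cells X n \<rightarrow> cells X m) \<and>
     (\<forall>n. \<forall>c \<in> cells X n. restr X n n (\<lambda>x \<in> cube n. x) c = c) \<and>
     (\<forall>l m n. \<forall>\<phi> \<in> box_hom l m. \<forall>\<psi> \<in> box_hom m n. \<forall>c \<in> cells X n.
        restr X l n (compose (cube l) \<psi> \<phi>) c = restr X l m \<phi> (restr X m n \<psi> c))"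

definition cubeset_hom ::
    "('c, 'y) cubeset_scheme \<Rightarrow> ('d, 'z) cubeset_scheme \<Rightarrow> (nat \<Rightarrow> 'c \<Rightarrow> 'd) set" where
  "cubeset_hom X Y = {\<eta>. (\<forall>m. \<eta> m \<in> cells X m \<rightarrow>\<^sub>E cells Y m) \<and>
     (\<forall>m n. \<forall>\<phi> \<in> box_hom m n. \<forall>c \<in> cells X n.
        \<eta> m (restr X m n \<phi> c) = restr Y m n \<phi> (\<eta> n c))}"

text \<open>Abelian group objects in cubesets, written multiplicatively: products of presheaves are
  formed levelwise, so these are the presheaves of abelian groups.\<close>

record 'c cubegroup = "'c cubeset" +
  cmult :: "nat \<Rightarrow> 'c \<Rightarrow> 'c \<Rightarrow> 'c"
  cone :: "nat \<Rightarrow> 'c"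

definition level :: "('c, 'z) cubegroup_scheme \<Rightarrow> nat \<Rightarrow> 'c monoid" where
  "level X m = \<lparr>carrier = cells X m, mult = cmult X m, one = cone X m\<rparr>"

definition is_cubegroup :: "('c, 'z) cubegroup_scheme \<Rightarrow> bool" where
  "is_cubegroup X \<longleftrightarrow> is_cubeset X \<and> (\<forall>m. comm_group (level X m)) \<and>
     (\<forall>m n. \<forall>\<phi> \<in> box_hom m n. restr X m n \<phi> \<in> hom (level X n) (level X m))"


section \<open>Host--Kra cubegroups\<close>

text \<open>Abelian groups are the multiplicatively written commutative groups of \<open>HOL-Algebra\<close>,
  with \<open>A 0\<close> the whole group.\<close>

locale filtered_comm_group = comm_group G for G (structure) +
  fixes A :: "nat \<Rightarrow> 'a set"
  assumes A_0: "A 0 = carrier G"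
    and A_subgroup: "subgroup (A n) G"
    and A_Suc: "A (Suc n) \<subseteq> A n"

definition HK_cubes :: "('a, 'z) monoid_scheme \<Rightarrow> (nat \<Rightarrow> 'a set) \<Rightarrow> nat \<Rightarrow> ((nat \<Rightarrow> int) \<Rightarrow> 'a) set"
  where
  "HK_cubes G A n = {c. \<exists>a. (\<forall>S \<in> Pow {..<n}. a S \<in> A (card S)) \<and>
     c = (\<lambda>x \<in> cube n. \<Otimes>\<^bsub>G\<^esub>S \<in> Pow {..<n}. a S [^]\<^bsub>G\<^esub> (\<Prod>i\<in>S. x i))}"

definition HK :: "('a, 'z) monoid_scheme \<Rightarrow> (nat \<Rightarrow> 'a set) \<Rightarrow> ((nat \<Rightarrow> int) \<Rightarrow> 'a) cubegroup" where
  "HK G A = \<lparr>cells = HK_cubes G A,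
     restr = (\<lambda>m n \<phi> c. compose (cube m) c \<phi>),
     cmult = (\<lambda>m c d. \<lambda>x \<in> cube m. c x \<otimes>\<^bsub>G\<^esub> d x),
     cone = (\<lambda>m. \<lambda>x \<in> cube m. \<one>\<^bsub>G\<^esub>)\<rparr>"


section \<open>Simplicial abelian groups and the normalized Moore complex\<close>

definition simplex_hom :: "nat \<Rightarrow> nat \<Rightarrow> (nat \<Rightarrow> nat) set" where
  "simplex_hom k n = {\<sigma> \<in> {..k} \<rightarrow>\<^sub>E {..n}. mono_on {..k} \<sigma>}"

text \<open>For \<open>i \<le> n\<close>, the coface map \<open>[n - 1] \<rightarrow> [n]\<close> that misses \<open>i\<close> (here \<open>n > 0\<close>),
  and for \<open>i < k\<close> the codegeneracy \<open>[k] \<rightarrow> [k - 1]\<close> that identifies \<open>i\<close> and \<open>i + 1\<close>.\<close>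

definition coface :: "nat \<Rightarrow> nat \<Rightarrow> nat \<Rightarrow> nat" where
  "coface n i = (\<lambda>j \<in> {..n - 1}. if j < i then j else Suc j)"

definition codegen :: "nat \<Rightarrow> nat \<Rightarrow> nat \<Rightarrow> nat" where
  "codegen k i = (\<lambda>j \<in> {..k}. if j \<le> i then j else j - 1)"

text \<open>A map \<^term>\<open>\<sigma> \<in> simplex_hom k n\<close> acts by \<open>spull X k n \<sigma>\<close>, from \<open>sgroup X n\<close> to
  \<open>sgroup X k\<close>.\<close>

record 's simplicial =
  sgroup :: "nat \<Rightarrow> 's monoid"
  spull :: "nat \<Rightarrow> nat \<Rightarrow> (nat \<Rightarrow> nat) \<Rightarrow> 's \<Rightarrow> 's"

definition simplicial_comm_group :: "('s, 'z) simplicial_scheme \<Rightarrow> bool" where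
  "simplicial_comm_group X \<longleftrightarrow>
     (\<forall>n. comm_group (sgroup X n)) \<and>
     (\<forall>k n. \<forall>\<sigma> \<in> simplex_hom k n. spull X k n \<sigma> \<in> hom (sgroup X n) (sgroup X k)) \<and>
     (\<forall>n. \<forall>x \<in> carrier (sgroup X n). spull X n n (\<lambda>j \<in> {..n}. j) x = x) \<and>
     (\<forall>l k n. \<forall>\<tau> \<in> simplex_hom l k. \<forall>\<sigma> \<in> simplex_hom k n. \<forall>x \<in> carrier (sgroup X n).
        spull X l n (compose {..l} \<sigma> \<tau>) x = spull X l k \<tau> (spull X k n \<sigma> x))"

definition face :: "('s, 'z) simplicial_scheme \<Rightarrow> nat \<Rightarrow> nat \<Rightarrow> 's \<Rightarrow> 's" where
  "face X n i = spull X (n - 1) n (coface n i)"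

text \<open>Convention: the kernels of all faces except the zeroth, with the zeroth face as
  differential. \<open>moore_diff X n\<close> goes from degree \<open>n + 1\<close> to degree \<open>n\<close>.\<close>

definition moore_group :: "('s, 'z) simplicial_scheme \<Rightarrow> nat \<Rightarrow> 's monoid" where
  "moore_group X n = (sgroup X n)\<lparr>carrier :=
     {x \<in> carrier (sgroup X n). \<forall>i \<in> {1..n}. face X n i x = \<one>\<^bsub>sgroup X (n - 1)\<^esub>}\<rparr>"

definition moore_diff :: "('s, 'z) simplicial_scheme \<Rightarrow> nat \<Rightarrow> 's \<Rightarrow> 's" where
  "moore_diff X n = face X (Suc n) 0"


section \<open>The cosimplicial cubeset K and its associated simplicial sets\<close>

definition Sub :: "nat \<Rightarrow> nat set set" where
  "Sub n = {S. S \<subseteq> {..n} \<and> S \<noteq> {}}"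

definition formal_cubes :: "nat \<Rightarrow> ((nat \<Rightarrow> int) \<Rightarrow> nat set) set" where
  "formal_cubes k = cube k \<rightarrow>\<^sub>E Sub k"

definition degenerable :: "nat \<Rightarrow> ((nat \<Rightarrow> int) \<Rightarrow> nat set) \<Rightarrow> bool" where
  "degenerable k F \<longleftrightarrow> (\<forall>i<k. \<forall>x \<in> cube k. \<forall>y \<in> cube k.
     (\<forall>j<k. j \<noteq> i \<longrightarrow> x j = y j) \<longrightarrow> codegen k i ` F x = codegen k i ` F y)"

definition K_cubes :: "nat \<Rightarrow> nat \<Rightarrow> ((nat \<Rightarrow> int) \<Rightarrow> nat set) set" where
  "K_cubes n m = {c. \<exists>k. \<exists>\<phi> \<in> box_hom m k. \<exists>F \<in> formal_cubes k. \<exists>\<sigma> \<in> simplex_hom k n.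
     degenerable k F \<and> c = (\<lambda>x \<in> cube m. \<sigma> ` F (\<phi> x))}"

definition K :: "nat \<Rightarrow> ((nat \<Rightarrow> int) \<Rightarrow> nat set) cubeset" where
  "K n = \<lparr>cells = K_cubes n, restr = (\<lambda>m l \<phi> c. compose (cube m) c \<phi>)\<rparr>"

definition K_push :: "(nat \<Rightarrow> nat) \<Rightarrow> nat \<Rightarrow> ((nat \<Rightarrow> int) \<Rightarrow> nat set) \<Rightarrow> (nat \<Rightarrow> int) \<Rightarrow> nat set" where
  "K_push \<sigma> m c = (\<lambda>x \<in> cube m. \<sigma> ` c x)"

definition Kstar ::
    "('c, 'z) cubegroup_scheme \<Rightarrow> (nat \<Rightarrow> ((nat \<Rightarrow> int) \<Rightarrow> nat set) \<Rightarrow> 'c) simplicial" where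
  "Kstar X = \<lparr>
     sgroup = (\<lambda>n. \<lparr>carrier = cubeset_hom (K n) X,
       mult = (\<lambda>\<eta> \<theta> m. \<lambda>c \<in> cells (K n) m. cmult X m (\<eta> m c) (\<theta> m c)),
       one = (\<lambda>m. \<lambda>c \<in> cells (K n) m. cone X m)\<rparr>),
     spull = (\<lambda>k n \<sigma> \<eta> m. \<lambda>c \<in> cells (K k) m. \<eta> m (K_push \<sigma> m c))\<rparr>"


section \<open>Well-definedness\<close>

lemma restrict_in_box_hom: "(\<lambda>x \<in> cube n. x) \<in> box_hom n n"
proof -
  have "x j = 0 + (\<Sum>i<n. (if i = j then 1 else 0) * x i)" if "j < n" for x :: "nat \<Rightarrow> int" and j
  proof -
    have "(\<Sum>i<n. (if i = j then 1 else 0) * x i) = (\<Sum>i<n. if i = j then x i else 0)"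
      by (rule sum.cong) auto
    with that show ?thesis by simp
  qed
  then show ?thesis
    unfolding box_hom_def mem_Collect_eq
    by (intro conjI exI[of _ "\<lambda>j i. if i = j then 1 else 0"] exI[of _ "\<lambda>_. 0"]) auto
qed

lemma box_hom_compose:
  assumes "\<phi> \<in> box_hom l m" "\<psi> \<in> box_hom m n"
  shows "compose (cube l) \<psi> \<phi> \<in> box_hom l n"
proof -
  obtain M b where M: "\<And>x j. x \<in> cube l \<Longrightarrow> j < m \<Longrightarrow> \<phi> x j = b j + (\<Sum>i<l. M j i * x i)"
    using assms(1) unfolding box_hom_def by blast
  obtain N c where N: "\<And>x j. x \<in> cube m \<Longrightarrow> j < n \<Longrightarrow> \<psi> x j = c j + (\<Sum>i<m. N j i * x i)"
    using assms(2) unfolding box_hom_def by blast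
  have mem: "\<phi> \<in> cube l \<rightarrow>\<^sub>E cube m" "\<psi> \<in> cube m \<rightarrow>\<^sub>E cube n"
    using assms unfolding box_hom_def by auto
  have "compose (cube l) \<psi> \<phi> x j =
      (c j + (\<Sum>i<m. N j i * b i)) + (\<Sum>k<l. (\<Sum>i<m. N j i * M i k) * x k)"
    if x: "x \<in> cube l" and j: "j < n" for x j
  proof -
    have "\<phi> x \<in> cube m" using mem x by auto
    then have "compose (cube l) \<psi> \<phi> x j = c j + (\<Sum>i<m. N j i * \<phi> x i)"
      using N x j by (simp add: compose_def)
    also have "\<dots> = c j + (\<Sum>i<m. N j i * b i + (\<Sum>k<l. N j i * M i k * x k))"
      using M x by (simp add: distrib_left sum_distrib_left mult.assoc)
    also have "(\<Sum>i<m. N j i * b i + (\<Sum>k<l. N j i * M i k * x k)) =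
        (\<Sum>i<m. N j i * b i) + (\<Sum>k<l. \<Sum>i<m. N j i * M i k * x k)"
      by (simp add: sum.distrib) (rule sum.swap)
    finally show ?thesis by (simp add: sum_distrib_right)
  qed
  moreover have "compose (cube l) \<psi> \<phi> \<in> cube l \<rightarrow>\<^sub>E cube n"
    using mem by (auto simp: compose_def PiE_def Pi_def)
  ultimately show ?thesis unfolding box_hom_def
    by (intro CollectI conjI exI[of _ "\<lambda>j k. \<Sum>i<m. N j i * M i k"]
        exI[of _ "\<lambda>j. c j + (\<Sum>i<m. N j i * b i)"]) auto
qed

lemma cubeset_homI:
  assumes "\<And>m c. c \<in> cells X m \<Longrightarrow> \<eta> m c \<in> cells Y m"
    and "\<And>m c. c \<notin> cells X m \<Longrightarrow> \<eta> m c = undefined"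
    and "\<And>m n \<phi> c. \<phi> \<in> box_hom m n \<Longrightarrow> c \<in> cells X n \<Longrightarrow>
      \<eta> m (restr X m n \<phi> c) = restr Y m n \<phi> (\<eta> n c)"
  shows "\<eta> \<in> cubeset_hom X Y"
  using assms by (auto simp: cubeset_hom_def)

lemma box_hom_cube: "\<phi> \<in> box_hom m n \<Longrightarrow> x \<in> cube m \<Longrightarrow> \<phi> x \<in> cube n"
  by (auto simp: box_hom_def)

lemma simplex_hom_compose:
  assumes "\<tau> \<in> simplex_hom l k" "\<sigma> \<in> simplex_hom k n"
  shows "compose {..l} \<sigma> \<tau> \<in> simplex_hom l n"
  using assms by (auto simp: simplex_hom_def compose_def mono_on_def PiE_iff)

lemma coface_in_simplex_hom: "coface (Suc n) i \<in> simplex_hom n (Suc n)"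
  by (auto simp: coface_def simplex_hom_def mono_on_def PiE_iff)

lemma K_cubes_image_subset:
  assumes "c \<in> K_cubes n m" "x \<in> cube m"
  shows "c x \<subseteq> {..n}"
proof -
  obtain k \<phi> F \<sigma> where *: "\<phi> \<in> box_hom m k" "F \<in> formal_cubes k" "\<sigma> \<in> simplex_hom k n"
    "c = (\<lambda>x \<in> cube m. \<sigma> ` F (\<phi> x))"
    using assms(1) unfolding K_cubes_def by blast
  have "F (\<phi> x) \<subseteq> {..k}"
    using *(1,2) box_hom_cube[OF *(1) assms(2)] by (auto simp: formal_cubes_def Sub_def PiE_iff)
  with *(3,4) assms(2) show ?thesis by (auto simp: simplex_hom_def PiE_iff)
qed

lemma K_cubes_extensional: "c \<in> K_cubes n m \<Longrightarrow> c \<in> extensional (cube m)"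
  unfolding K_cubes_def by auto

lemma K_cubes_restr:
  assumes "c \<in> K_cubes n m" "\<phi> \<in> box_hom l m"
  shows "compose (cube l) c \<phi> \<in> K_cubes n l"
proof -
  obtain k \<psi> F \<sigma> where *: "\<psi> \<in> box_hom m k" "F \<in> formal_cubes k" "\<sigma> \<in> simplex_hom k n"
    "degenerable k F" "c = (\<lambda>x \<in> cube m. \<sigma> ` F (\<psi> x))"
    using assms(1) unfolding K_cubes_def by blast
  have "compose (cube l) c \<phi> = (\<lambda>x \<in> cube l. \<sigma> ` F (compose (cube l) \<psi> \<phi> x))"
    using box_hom_cube[OF assms(2)] by (auto simp: *(5) compose_def fun_eq_iff)
  with * box_hom_compose[OF assms(2) *(1)] show ?thesis unfolding K_cubes_def by blast
qed

lemma is_cubeset_K: "is_cubeset (K n)"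
  unfolding is_cubeset_def
proof (intro conjI allI ballI)
  fix m l \<phi> assume "\<phi> \<in> box_hom m l"
  then show "restr (K n) m l \<phi> \<in> cells (K n) l \<rightarrow> cells (K n) m"
    by (auto simp: K_def K_cubes_restr)
next
  fix m c assume "c \<in> cells (K n) m"
  then have "c \<in> extensional (cube m)" by (simp add: K_def K_cubes_extensional)
  then show "restr (K n) m m (\<lambda>x \<in> cube m. x) c = c"
    by (auto simp: K_def compose_def fun_eq_iff extensional_def)
next
  fix l m k \<phi> \<psi> c
  assume "\<phi> \<in> box_hom l m"
  then show "restr (K n) l k (compose (cube l) \<psi> \<phi>) c = restr (K n) l m \<phi> (restr (K n) m k \<psi> c)"
    using box_hom_cube by (auto simp: K_def compose_def fun_eq_iff)
qed

lemma K_push_hom: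
  assumes "\<sigma> \<in> simplex_hom k n"
  shows "(\<lambda>m. restrict (K_push \<sigma> m) (cells (K k) m)) \<in> cubeset_hom (K k) (K n)"
proof -
  have 1: "K_push \<sigma> m c \<in> K_cubes n m" if c: "c \<in> K_cubes k m" for m c
  proof -
    obtain l \<psi> F \<tau> where *: "\<psi> \<in> box_hom m l" "F \<in> formal_cubes l" "\<tau> \<in> simplex_hom l k"
      "degenerable l F" "c = (\<lambda>x \<in> cube m. \<tau> ` F (\<psi> x))"
      using c unfolding K_cubes_def by blast
    have "F (\<psi> x) \<subseteq> {..l}" if "x \<in> cube m" for x
      using *(2) box_hom_cube[OF *(1) that] by (auto simp: formal_cubes_def Sub_def PiE_iff)
    then have "K_push \<sigma> m c = (\<lambda>x \<in> cube m. compose {..l} \<sigma> \<tau> ` F (\<psi> x))"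
      by (auto simp: K_push_def *(5) compose_def fun_eq_iff image_image intro!: image_cong)
    with * simplex_hom_compose[OF *(3) assms] show ?thesis unfolding K_cubes_def by blast
  qed
  have 2: "K_push \<sigma> m (compose (cube m) c \<phi>) = compose (cube m) (K_push \<sigma> l c) \<phi>"
    if "\<phi> \<in> box_hom m l" for m l c \<phi>
    using box_hom_cube[OF that] by (auto simp: K_push_def compose_def fun_eq_iff)
  show ?thesis using 1 2 K_cubes_restr by (auto simp: cubeset_hom_def K_def)
qed

lemma K_push_in: "\<sigma> \<in> simplex_hom k n \<Longrightarrow> c \<in> cells (K k) m \<Longrightarrow> K_push \<sigma> m c \<in> cells (K n) m"
  using K_push_hom[of \<sigma> k n] by (auto simp: cubeset_hom_def PiE_iff)

lemma K_push_restr: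
  "\<phi> \<in> box_hom m l \<Longrightarrow> K_push \<sigma> m (restr (K k) m l \<phi> c) = restr (K n) m l \<phi> (K_push \<sigma> l c)"
  using box_hom_cube[of \<phi> m l] by (auto simp: K_push_def K_def compose_def fun_eq_iff)

lemma K_push_id:
  assumes "c \<in> cells (K n) m" shows "K_push (\<lambda>j \<in> {..n}. j) m c = c"
proof -
  have "c \<in> K_cubes n m" using assms by (simp add: K_def)
  then show ?thesis
    using K_cubes_image_subset[of c n m] K_cubes_extensional[of c n m]
    by (fastforce simp: K_push_def fun_eq_iff extensional_def)
qed

lemma K_push_compose:
  assumes "c \<in> cells (K l) m"
  shows "K_push (compose {..l} \<sigma> \<tau>) m c = K_push \<sigma> m (K_push \<tau> m c)"
proof -
  have "c \<in> K_cubes l m" using assms by (simp add: K_def)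
  then show ?thesis
    using K_cubes_image_subset[of c l m]
    by (auto simp: K_push_def fun_eq_iff compose_def image_image intro!: image_cong)
qed

text \<open>For an abelian group object \<open>X\<close>, \<open>K\<^sup>*X\<close> is a simplicial abelian group.\<close>

lemma simplicial_comm_group_Kstar:
  assumes X: "is_cubegroup X"
  shows "simplicial_comm_group (Kstar X)"
proof -
  have G: "comm_group (level X m)" for m using X by (simp add: is_cubegroup_def)
  have gr: "group (level X m)" for m using G by (simp add: comm_group.axioms)
  have closed: "cmult X m a b \<in> cells X m" if "a \<in> cells X m" "b \<in> cells X m" for m a b
    using monoid.m_closed[OF group.is_monoid[OF gr[of m]]] that by (simp add: level_def)
  have cl1: "cone X m \<in> cells X m" for m
    using monoid.one_closed[OF group.is_monoid[OF gr[of m]]] by (simp add: level_def)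
  have assoc: "cmult X m (cmult X m a b) c = cmult X m a (cmult X m b c)"
    if "a \<in> cells X m" "b \<in> cells X m" "c \<in> cells X m" for m a b c
    using monoid.m_assoc[OF group.is_monoid[OF gr[of m]]] that by (simp add: level_def)
  have comm: "cmult X m a b = cmult X m b a" if "a \<in> cells X m" "b \<in> cells X m" for m a b
    using comm_monoid.m_comm[OF comm_group.axioms(1)[OF G[of m]]] that by (simp add: level_def)
  have lone: "cmult X m (cone X m) a = a" if "a \<in> cells X m" for m a
    using monoid.l_one[OF group.is_monoid[OF gr[of m]]] that by (simp add: level_def)
  define iv where "iv m a = m_inv (level X m) a" for m a
  have ivc: "iv m a \<in> cells X m" and ivl: "cmult X m (iv m a) a = cone X m"
    if "a \<in> cells X m" for m a
    using group.inv_closed[OF gr[of m], of a] group.l_inv[OF gr[of m], of a] that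
    by (simp_all add: level_def iv_def)
  have hom: "restr X m n \<phi> \<in> hom (level X n) (level X m)" if "\<phi> \<in> box_hom m n" for m n \<phi>
    using X that by (simp add: is_cubegroup_def)
  have rcl: "restr X m n \<phi> a \<in> cells X m" if "\<phi> \<in> box_hom m n" "a \<in> cells X n" for m n \<phi> a
    using hom[OF that(1)] that(2) by (auto simp: hom_def level_def)
  have rmult: "restr X m n \<phi> (cmult X n a b) = cmult X m (restr X m n \<phi> a) (restr X m n \<phi> b)"
    if "\<phi> \<in> box_hom m n" "a \<in> cells X n" "b \<in> cells X n" for m n \<phi> a b
    using hom[OF that(1)] that(2,3) by (auto simp: hom_def level_def)
  have rone: "restr X m n \<phi> (cone X n) = cone X m" if "\<phi> \<in> box_hom m n" for m n \<phi>
    using hom_one[OF hom[OF that] gr gr] by (simp add: level_def)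
  have rinv: "restr X m n \<phi> (iv n a) = iv m (restr X m n \<phi> a)"
    if "\<phi> \<in> box_hom m n" "a \<in> cells X n" for m n \<phi> a
    using group_hom.hom_inv[of "level X n" "level X m" "restr X m n \<phi>" a] hom[OF that(1)] gr that(2)
    by (simp add: group_hom_def group_hom_axioms_def iv_def level_def)
  have Kr: "restr (K n) m l \<phi> c \<in> cells (K n) m" if "\<phi> \<in> box_hom m l" "c \<in> cells (K n) l" for n m l \<phi> c
    using is_cubeset_K[of n] that by (auto simp: is_cubeset_def)
  have H: "\<eta> m c \<in> cells X m" if "\<eta> \<in> cubeset_hom (K n) X" "c \<in> cells (K n) m" for \<eta> n m c
    using that by (auto simp: cubeset_hom_def PiE_iff)
  have Hext: "\<eta> m c = undefined" if "\<eta> \<in> cubeset_hom (K n) X" "c \<notin> cells (K n) m" for \<eta> n m c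
    using that by (auto simp: cubeset_hom_def PiE_iff extensional_def)
  have Hnat: "\<eta> m (restr (K n) m l \<phi> c) = restr X m l \<phi> (\<eta> l c)"
    if "\<eta> \<in> cubeset_hom (K n) X" "\<phi> \<in> box_hom m l" "c \<in> cells (K n) l" for \<eta> n m l \<phi> c
    using that by (auto simp: cubeset_hom_def)
  have hcl: "(\<lambda>m. \<lambda>c \<in> cells (K n) m. cmult X m (\<eta> m c) (\<theta> m c)) \<in> cubeset_hom (K n) X"
    if "\<eta> \<in> cubeset_hom (K n) X" "\<theta> \<in> cubeset_hom (K n) X" for \<eta> \<theta> n
    using that by (intro cubeset_homI) (auto simp: H closed Kr Hnat rmult)
  have h1: "(\<lambda>m. \<lambda>c \<in> cells (K n) m. cone X m) \<in> cubeset_hom (K n) X" for n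
    by (intro cubeset_homI) (auto simp: cl1 Kr rone)
  have hiv: "(\<lambda>m. \<lambda>c \<in> cells (K n) m. iv m (\<eta> m c)) \<in> cubeset_hom (K n) X"
    if "\<eta> \<in> cubeset_hom (K n) X" for \<eta> n
    using that by (intro cubeset_homI) (auto simp: H ivc Kr Hnat rinv)
  have hp: "(\<lambda>m. \<lambda>c \<in> cells (K k) m. \<eta> m (K_push \<sigma> m c)) \<in> cubeset_hom (K k) X"
    if "\<eta> \<in> cubeset_hom (K n) X" "\<sigma> \<in> simplex_hom k n" for \<eta> \<sigma> k n
    using that by (intro cubeset_homI) (auto simp: H Kr Hnat K_push_in K_push_restr[where n=n])
  have cg: "comm_group (sgroup (Kstar X) n)" for n
  proof (rule comm_groupI)
    fix \<eta> assume e: "\<eta> \<in> carrier (sgroup (Kstar X) n)"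
    show "\<exists>\<theta> \<in> carrier (sgroup (Kstar X) n).
        \<theta> \<otimes>\<^bsub>sgroup (Kstar X) n\<^esub> \<eta> = \<one>\<^bsub>sgroup (Kstar X) n\<^esub>"
      using e hiv[of \<eta> n]
      by (intro bexI[of _ "\<lambda>m. \<lambda>c \<in> cells (K n) m. iv m (\<eta> m c)"])
         (auto simp: Kstar_def ivl H fun_eq_iff)
  qed (auto simp: Kstar_def hcl h1 assoc lone H Hext fun_eq_iff intro: comm)
  show ?thesis
    unfolding simplicial_comm_group_def
  proof (intro conjI allI ballI)
    fix n show "comm_group (sgroup (Kstar X) n)" by (rule cg)
  next
    fix k n \<sigma> assume "\<sigma> \<in> simplex_hom k n"
    then show "spull (Kstar X) k n \<sigma> \<in> hom (sgroup (Kstar X) n) (sgroup (Kstar X) k)"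
      by (auto simp: hom_def Kstar_def hp K_push_in fun_eq_iff)
  next
    fix n x assume "x \<in> carrier (sgroup (Kstar X) n)"
    then show "spull (Kstar X) n n (\<lambda>j \<in> {..n}. j) x = x"
      by (auto simp: Kstar_def K_push_id Hext fun_eq_iff)
  next
    fix l k n \<tau> \<sigma> x
    assume "\<tau> \<in> simplex_hom l k"
    then show "spull (Kstar X) l n (compose {..l} \<sigma> \<tau>) x =
        spull (Kstar X) l k \<tau> (spull (Kstar X) k n \<sigma> x)"
      by (auto simp: Kstar_def K_push_compose K_push_in fun_eq_iff)
  qed
qed

lemma moore_diff_hom:
  assumes X: "simplicial_comm_group X"
  shows "moore_diff X n \<in> hom (moore_group X (Suc n)) (moore_group X n)"
    and "x \<in> carrier (moore_group X (Suc (Suc n))) \<Longrightarrow>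
      moore_diff X n (moore_diff X (Suc n) x) = \<one>\<^bsub>moore_group X n\<^esub>"
proof -
  have gr: "group (sgroup X n)" for n
    using X by (simp add: simplicial_comm_group_def comm_group.axioms)
  have fh: "face X (Suc n) i \<in> hom (sgroup X (Suc n)) (sgroup X n)" for n i
    using X coface_in_simplex_hom[of n i] by (simp add: simplicial_comm_group_def face_def)
  have f1: "face X (Suc n) i \<one>\<^bsub>sgroup X (Suc n)\<^esub> = \<one>\<^bsub>sgroup X n\<^esub>" for n i
    using hom_one[OF fh gr gr] .
  have comp: "spull X n (Suc (Suc n)) (compose {..n} (coface (Suc (Suc n)) j) (coface (Suc n) i)) x =
      face X (Suc n) i (face X (Suc (Suc n)) j x)" if "x \<in> carrier (sgroup X (Suc (Suc n)))" for n i j x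
    using X that coface_in_simplex_hom[of n i] coface_in_simplex_hom[of "Suc n" j]
    unfolding simplicial_comm_group_def face_def by simp
  have ff: "face X (Suc n) i (face X (Suc (Suc n)) 0 x) = face X (Suc n) 0 (face X (Suc (Suc n)) (Suc i) x)"
    if "x \<in> carrier (sgroup X (Suc (Suc n)))" for n i x
  proof -
    have "compose {..n} (coface (Suc (Suc n)) 0) (coface (Suc n) i) =
        compose {..n} (coface (Suc (Suc n)) (Suc i)) (coface (Suc n) 0)"
      by (auto simp: coface_def compose_def fun_eq_iff)
    then show ?thesis using comp[OF that, of 0 i] comp[OF that, of "Suc i" 0] by simp
  qed
  have "face X n i (face X (Suc n) 0 x) = \<one>\<^bsub>sgroup X (n - 1)\<^esub>"
    if "x \<in> carrier (moore_group X (Suc n))" "i \<in> {1..n}" for x i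
    using that ff[of x "n - 1" i] f1[of "n - 1" 0] by (cases n) (auto simp: moore_group_def)
  then show "moore_diff X n \<in> hom (moore_group X (Suc n)) (moore_group X n)"
    using fh[of n 0] by (auto simp: hom_def moore_diff_def moore_group_def)
  show "moore_diff X n (moore_diff X (Suc n) x) = \<one>\<^bsub>moore_group X n\<^esub>"
    if "x \<in> carrier (moore_group X (Suc (Suc n)))"
    using that ff[of x n 0] f1[of n 0] by (auto simp: moore_group_def moore_diff_def)
qed

context filtered_comm_group
begin

lemma A_in_carrier: "a \<in> A n \<Longrightarrow> a \<in> carrier G"
  using subgroup.mem_carrier[OF A_subgroup] .

lemma A_antimono: "m \<le> n \<Longrightarrow> A n \<subseteq> A m"
  by (induction n rule: dec_induct) (use A_Suc in auto)

lemma A_int_pow: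
  assumes "a \<in> A n" shows "a [^] (z :: int) \<in> A n"
proof -
  interpret S: subgroup "A n" G by (rule A_subgroup)
  interpret S: group "G\<lparr>carrier := A n\<rparr>" by (rule subgroup_imp_group[OF A_subgroup])
  show ?thesis using S.int_pow_closed[of a z] int_pow_consistent[OF A_subgroup assms] assms by simp
qed

lemma A_int_pow_carrier: "a \<in> A n \<Longrightarrow> a [^] (z :: int) \<in> carrier G"
  using A_in_carrier by blast

lemma HK_cubes_carrier: "c \<in> HK_cubes G A n \<Longrightarrow> x \<in> cube n \<Longrightarrow> c x \<in> carrier G"
  unfolding HK_cubes_def by (auto intro!: finprod_closed A_int_pow_carrier)

lemma HK_cubes_extensional: "c \<in> HK_cubes G A n \<Longrightarrow> c \<in> extensional (cube n)"
  unfolding HK_cubes_def by auto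

lemma HK_cubes_mult:
  assumes "c \<in> HK_cubes G A n" "d \<in> HK_cubes G A n"
  shows "(\<lambda>x \<in> cube n. c x \<otimes> d x) \<in> HK_cubes G A n"
proof -
  obtain a where a: "\<And>S. S \<in> Pow {..<n} \<Longrightarrow> a S \<in> A (card S)"
    "c = (\<lambda>x \<in> cube n. \<Otimes>S \<in> Pow {..<n}. a S [^] (\<Prod>i\<in>S. x i))"
    using assms(1) unfolding HK_cubes_def by auto
  obtain b where b: "\<And>S. S \<in> Pow {..<n} \<Longrightarrow> b S \<in> A (card S)"
    "d = (\<lambda>x \<in> cube n. \<Otimes>S \<in> Pow {..<n}. b S [^] (\<Prod>i\<in>S. x i))"
    using assms(2) unfolding HK_cubes_def by auto
  have "c x \<otimes> d x = (\<Otimes>S \<in> Pow {..<n}. (a S \<otimes> b S) [^] (\<Prod>i\<in>S. x i))" if "x \<in> cube n" for x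
  proof -
    have "(\<lambda>S. a S [^] (\<Prod>i\<in>S. x i)) \<in> Pow {..<n} \<rightarrow> carrier G"
      "(\<lambda>S. b S [^] (\<Prod>i\<in>S. x i)) \<in> Pow {..<n} \<rightarrow> carrier G"
      using A_int_pow_carrier[OF a(1)] A_int_pow_carrier[OF b(1)] by (simp_all add: Pi_def)
    note * = finprod_multf[OF this]
    have "c x \<otimes> d x = (\<Otimes>S \<in> Pow {..<n}. a S [^] (\<Prod>i\<in>S. x i) \<otimes> b S [^] (\<Prod>i\<in>S. x i))"
      unfolding * using that by (simp add: a(2) b(2))
    also have "\<dots> = (\<Otimes>S \<in> Pow {..<n}. (a S \<otimes> b S) [^] (\<Prod>i\<in>S. x i))"
      using A_in_carrier[OF a(1)] A_in_carrier[OF b(1)]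
      by (intro finprod_cong') (auto simp: int_pow_distrib)
    finally show ?thesis .
  qed
  moreover have "\<forall>S \<in> Pow {..<n}. a S \<otimes> b S \<in> A (card S)"
    using subgroup.m_closed[OF A_subgroup a(1) b(1)] by simp
  ultimately show ?thesis unfolding HK_cubes_def
    by (intro CollectI exI[of _ "\<lambda>S. a S \<otimes> b S"] conjI restrict_ext)
qed

lemma HK_cubes_inv:
  assumes "c \<in> HK_cubes G A n"
  shows "(\<lambda>x \<in> cube n. inv (c x)) \<in> HK_cubes G A n"
proof -
  obtain a where a: "\<And>S. S \<in> Pow {..<n} \<Longrightarrow> a S \<in> A (card S)"
    "c = (\<lambda>x \<in> cube n. \<Otimes>S \<in> Pow {..<n}. a S [^] (\<Prod>i\<in>S. x i))"
    using assms(1) unfolding HK_cubes_def by auto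
  have "inv (c x) = (\<Otimes>S \<in> Pow {..<n}. (inv (a S)) [^] (\<Prod>i\<in>S. x i))" if "x \<in> cube n" for x
  proof (rule inv_equality)
    have "(\<lambda>S. a S [^] (\<Prod>i\<in>S. x i)) \<in> Pow {..<n} \<rightarrow> carrier G"
      "(\<lambda>S. inv (a S) [^] (\<Prod>i\<in>S. x i)) \<in> Pow {..<n} \<rightarrow> carrier G"
      using A_int_pow_carrier[OF a(1)] A_in_carrier[OF a(1)] by (simp_all add: Pi_def)
    note * = finprod_multf[OF this(2,1)]
    have "(\<Otimes>S \<in> Pow {..<n}. (inv (a S)) [^] (\<Prod>i\<in>S. x i)) \<otimes> c x =
        (\<Otimes>S \<in> Pow {..<n}. (inv (a S)) [^] (\<Prod>i\<in>S. x i) \<otimes> a S [^] (\<Prod>i\<in>S. x i))"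
      unfolding * using that by (simp add: a(2))
    also have "\<dots> = \<one>"
    proof (rule finprod_one_eqI)
      fix S assume "S \<in> Pow {..<n}"
      then have "a S \<in> carrier G" using A_in_carrier[OF a(1)] by blast
      then show "(inv (a S)) [^] (\<Prod>i\<in>S. x i) \<otimes> a S [^] (\<Prod>i\<in>S. x i) = \<one>"
        using int_pow_distrib[of "inv (a S)" "a S" "\<Prod>i\<in>S. x i"] by simp
    qed
    finally show "(\<Otimes>S \<in> Pow {..<n}. (inv (a S)) [^] (\<Prod>i\<in>S. x i)) \<otimes> c x = \<one>" .
    show "c x \<in> carrier G" using HK_cubes_carrier[OF assms that] .
    show "(\<Otimes>S \<in> Pow {..<n}. (inv (a S)) [^] (\<Prod>i\<in>S. x i)) \<in> carrier G"
      using A_in_carrier[OF a(1)] by (intro finprod_closed) auto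
  qed
  moreover have "\<forall>S \<in> Pow {..<n}. inv (a S) \<in> A (card S)"
    using subgroup.m_inv_closed[OF A_subgroup a(1)] by simp
  ultimately show ?thesis unfolding HK_cubes_def
    by (intro CollectI exI[of _ "\<lambda>S. inv (a S)"] conjI restrict_ext)
qed

lemma HK_cubes_monomial:
  assumes "T \<subseteq> {..<n}" "a \<in> A (card T)"
  shows "(\<lambda>x \<in> cube n. a [^] (\<Prod>i\<in>T. x i)) \<in> HK_cubes G A n"
proof -
  let ?a = "\<lambda>S. if S = T then a else \<one>"
  have "(\<Otimes>S \<in> Pow {..<n}. ?a S [^] (\<Prod>i\<in>S. x i)) = a [^] (\<Prod>i\<in>T. x i)" for x :: "nat \<Rightarrow> int"
  proof -
    have "(\<Otimes>S \<in> Pow {..<n}. ?a S [^] (\<Prod>i\<in>S. x i)) =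
        (\<Otimes>S \<in> Pow {..<n}. if T = S then a [^] (\<Prod>i\<in>S. x i) else \<one>)"
      using assms(2) A_in_carrier by (intro finprod_cong') auto
    also have "\<dots> = a [^] (\<Prod>i\<in>T. x i)"
      using assms A_in_carrier by (intro finprod_singleton) auto
    finally show ?thesis .
  qed
  moreover have "\<forall>S \<in> Pow {..<n}. ?a S \<in> A (card S)"
    using assms(2) A_subgroup subgroup.one_closed by auto
  ultimately show ?thesis unfolding HK_cubes_def
    by (intro CollectI exI[of _ ?a]) (auto simp: fun_eq_iff)
qed

lemma HK_cubes_one: "(\<lambda>x \<in> cube n. \<one>) \<in> HK_cubes G A n"
  using HK_cubes_monomial[of "{}" n \<one>] A_0 by (simp only: card.empty int_pow_one) blast

lemma HK_cubes_affine_prod: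
  assumes "\<phi> \<in> box_hom m n" "finite S"
  shows "S \<subseteq> {..<n} \<Longrightarrow> T \<subseteq> {..<m} \<Longrightarrow> a \<in> A (card S + card T) \<Longrightarrow>
    (\<lambda>x \<in> cube m. a [^] ((\<Prod>i\<in>S. \<phi> x i) * (\<Prod>i\<in>T. x i))) \<in> HK_cubes G A m"
  using assms(2)
proof (induction S arbitrary: T a rule: finite_induct)
  case empty
  then show ?case using HK_cubes_monomial[of T m a] by (auto simp only: prod.empty mult_1 card.empty add_0)
next
  case (insert i S)
  obtain M b where M: "\<And>x j. x \<in> cube m \<Longrightarrow> j < n \<Longrightarrow> \<phi> x j = b j + (\<Sum>i<m. M j i * x i)"
    using assms(1) unfolding box_hom_def by blast
  define P where "P x = (\<Prod>i\<in>S. \<phi> x i) * (\<Prod>i\<in>T. x i)" for x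
  have a: "a \<in> carrier G" using insert.prems(3) A_in_carrier by blast
  have J: "(\<lambda>x \<in> cube m. a [^] ((b i + (\<Sum>j\<in>J. M i j * x j)) * P x)) \<in> HK_cubes G A m"
    if "finite J" "J \<subseteq> {..<m}" for J
    using that
  proof (induction J rule: finite_induct)
    case empty
    have "a [^] b i \<in> A (card S + card T)"
      using insert A_int_pow A_antimono[of "card S + card T" "card (insert i S) + card T"] by auto
    then have "(\<lambda>x \<in> cube m. (a [^] b i) [^] P x) \<in> HK_cubes G A m"
      unfolding P_def using insert.IH[of T] insert.prems by blast
    moreover have "(a [^] b i) [^] P x = a [^] ((b i + (\<Sum>j\<in>{}. M i j * x j)) * P x)" for x
      using a by (simp add: int_pow_pow)
    ultimately show ?case by (simp only:)
  next
    case (insert j J)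
    let ?T = "insert j T"
    have fT: "finite T" using \<open>T \<subseteq> {..<m}\<close> finite_subset by blast
    have "card ?T \<le> Suc (card T)" by (simp add: card_insert_if fT)
    then have "a [^] M i j \<in> A (card S + card ?T)"
      using A_int_pow[OF \<open>a \<in> A (card (Set.insert i S) + card T)\<close>] \<open>finite S\<close> \<open>i \<notin> S\<close>
        A_antimono[of "card S + card ?T" "card (Set.insert i S) + card T"] by auto
    then have 1: "(\<lambda>x \<in> cube m. (a [^] M i j) [^] ((\<Prod>i\<in>S. \<phi> x i) * (\<Prod>i\<in>?T. x i))) \<in> HK_cubes G A m"
      using \<open>Set.insert i S \<subseteq> {..<n}\<close> \<open>T \<subseteq> {..<m}\<close> \<open>Set.insert j J \<subseteq> {..<m}\<close>
      by (intro \<open>\<And>T a. S \<subseteq> {..<n} \<Longrightarrow> T \<subseteq> {..<m} \<Longrightarrow> a \<in> A (card S + card T) \<Longrightarrow>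
          (\<lambda>x \<in> cube m. a [^] ((\<Prod>i\<in>S. \<phi> x i) * (\<Prod>i\<in>T. x i))) \<in> HK_cubes G A m\<close>) auto
    have prod: "(\<Prod>i\<in>?T. x i) = x j * (\<Prod>i\<in>T. x i)" if "x \<in> cube m" for x
    proof (cases "j \<in> T")
      case True
      then have "x j * x j = x j" using that \<open>T \<subseteq> {..<m}\<close> by (auto simp: cube_def PiE_iff)
      then show ?thesis using True fT
        by (simp add: insert_absorb prod.remove[OF fT True] mult.assoc[symmetric])
    qed (use fT in simp)
    have "(\<lambda>x \<in> cube m. a [^] ((b i + (\<Sum>j\<in>Set.insert j J. M i j * x j)) * P x)) =
      (\<lambda>x \<in> cube m. (\<lambda>x \<in> cube m. a [^] ((b i + (\<Sum>j\<in>J. M i j * x j)) * P x)) x \<otimes>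
        (\<lambda>x \<in> cube m. (a [^] M i j) [^] ((\<Prod>i\<in>S. \<phi> x i) * (\<Prod>i\<in>?T. x i))) x)"
    proof (rule restrict_ext)
      fix x assume x: "x \<in> cube m"
      have "(b i + (\<Sum>j\<in>Set.insert j J. M i j * x j)) * P x =
          (b i + (\<Sum>j\<in>J. M i j * x j)) * P x + M i j * ((\<Prod>i\<in>S. \<phi> x i) * (\<Prod>i\<in>?T. x i))"
        using insert.hyps by (simp add: prod[OF x] P_def algebra_simps)
      then show "a [^] ((b i + (\<Sum>j\<in>Set.insert j J. M i j * x j)) * P x) =
        (\<lambda>x \<in> cube m. a [^] ((b i + (\<Sum>j\<in>J. M i j * x j)) * P x)) x \<otimes>
        (\<lambda>x \<in> cube m. (a [^] M i j) [^] ((\<Prod>i\<in>S. \<phi> x i) * (\<Prod>i\<in>?T. x i))) x"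
        using x a by (simp add: int_pow_mult int_pow_pow)
    qed
    moreover have "J \<subseteq> {..<m}" using \<open>Set.insert j J \<subseteq> {..<m}\<close> by blast
    ultimately show ?case using HK_cubes_mult[OF insert.IH 1] by (simp only:)
  qed
  have "(\<lambda>x \<in> cube m. a [^] ((\<Prod>i\<in>Set.insert i S. \<phi> x i) * (\<Prod>i\<in>T. x i))) =
      (\<lambda>x \<in> cube m. a [^] ((b i + (\<Sum>j<m. M i j * x j)) * P x))"
    using insert.hyps insert.prems M by (intro restrict_ext) (simp add: P_def mult.assoc)
  then show ?case using J[of "{..<m}"] by (simp only: finite_lessThan subset_refl)
qed

lemma HK_cubes_restr:
  assumes "\<phi> \<in> box_hom m n" "c \<in> HK_cubes G A n"
  shows "compose (cube m) c \<phi> \<in> HK_cubes G A m"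
proof -
  obtain a where a: "\<And>S. S \<in> Pow {..<n} \<Longrightarrow> a S \<in> A (card S)"
    "c = (\<lambda>x \<in> cube n. \<Otimes>S \<in> Pow {..<n}. a S [^] (\<Prod>i\<in>S. x i))"
    using assms(2) unfolding HK_cubes_def by auto
  have "(\<lambda>x \<in> cube m. \<Otimes>S \<in> \<S>. a S [^] (\<Prod>i\<in>S. \<phi> x i)) \<in> HK_cubes G A m"
    if "finite \<S>" "\<S> \<subseteq> Pow {..<n}" for \<S>
    using that
  proof (induction \<S> rule: finite_induct)
    case empty
    then show ?case by (simp only: finprod_empty HK_cubes_one)
  next
    case (insert S \<S>)
    have fS: "finite S" using insert.prems by (auto intro: finite_subset)
    have 1: "(\<lambda>x \<in> cube m. a S [^] (\<Prod>i\<in>S. \<phi> x i)) \<in> HK_cubes G A m"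
      using HK_cubes_affine_prod[OF assms(1) fS, of "{}" "a S"] a(1) insert.prems by simp
    have "(\<lambda>x \<in> cube m. \<Otimes>S \<in> Set.insert S \<S>. a S [^] (\<Prod>i\<in>S. \<phi> x i)) =
        (\<lambda>x \<in> cube m. (\<lambda>x \<in> cube m. a S [^] (\<Prod>i\<in>S. \<phi> x i)) x \<otimes>
          (\<lambda>x \<in> cube m. \<Otimes>S \<in> \<S>. a S [^] (\<Prod>i\<in>S. \<phi> x i)) x)"
    proof (rule restrict_ext)
      fix x assume x: "x \<in> cube m"
      have "a S' \<in> carrier G" if "S' \<in> Set.insert S \<S>" for S'
        using A_in_carrier[OF a(1), of S'] that insert.prems by blast
      then show "(\<Otimes>S \<in> Set.insert S \<S>. a S [^] (\<Prod>i\<in>S. \<phi> x i)) =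
        (\<lambda>x \<in> cube m. a S [^] (\<Prod>i\<in>S. \<phi> x i)) x \<otimes>
          (\<lambda>x \<in> cube m. \<Otimes>S \<in> \<S>. a S [^] (\<Prod>i\<in>S. \<phi> x i)) x"
        using insert.hyps x by (simp add: Pi_def)
    qed
    moreover have "\<S> \<subseteq> Pow {..<n}" using insert.prems by blast
    ultimately show ?case using HK_cubes_mult[OF 1 insert.IH] by (simp only:)
  qed
  from this[of "Pow {..<n}"] finite_Pow_iff[of "{..<n}"]
  have "(\<lambda>x \<in> cube m. \<Otimes>S \<in> Pow {..<n}. a S [^] (\<Prod>i\<in>S. \<phi> x i)) \<in> HK_cubes G A m"
    by (simp only: finite_lessThan subset_refl)
  moreover have "compose (cube m) c \<phi> = (\<lambda>x \<in> cube m. \<Otimes>S \<in> Pow {..<n}. a S [^] (\<Prod>i\<in>S. \<phi> x i))"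
    using box_hom_cube[OF assms(1)] by (simp add: a(2) compose_def fun_eq_iff)
  ultimately show ?thesis by (simp only:)
qed

lemma is_cubegroup_HK: "is_cubegroup (HK G A)"
  unfolding is_cubegroup_def is_cubeset_def
proof (intro conjI allI ballI)
  fix m l \<phi> assume "\<phi> \<in> box_hom m l"
  then show "restr (HK G A) m l \<phi> \<in> cells (HK G A) l \<rightarrow> cells (HK G A) m"
    by (auto simp: HK_def HK_cubes_restr)
next
  fix m c assume "c \<in> cells (HK G A) m"
  then have "c \<in> extensional (cube m)" by (simp add: HK_def HK_cubes_extensional)
  then show "restr (HK G A) m m (\<lambda>x \<in> cube m. x) c = c"
    by (auto simp: HK_def compose_def fun_eq_iff extensional_def)
next
  fix l m k \<phi> \<psi> c
  assume "\<phi> \<in> box_hom l m"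
  then show "restr (HK G A) l k (compose (cube l) \<psi> \<phi>) c =
      restr (HK G A) l m \<phi> (restr (HK G A) m k \<psi> c)"
    using box_hom_cube by (auto simp: HK_def compose_def fun_eq_iff)
next
  fix m
  show "comm_group (level (HK G A) m)"
  proof (rule comm_groupI)
    fix c assume "c \<in> carrier (level (HK G A) m)"
    then show "\<exists>d \<in> carrier (level (HK G A) m). d \<otimes>\<^bsub>level (HK G A) m\<^esub> c = \<one>\<^bsub>level (HK G A) m\<^esub>"
      using HK_cubes_inv[of c m] HK_cubes_carrier[of c m]
      by (intro bexI[of _ "\<lambda>x \<in> cube m. inv (c x)"]) (auto simp: level_def HK_def fun_eq_iff)
  qed (auto simp: level_def HK_def HK_cubes_mult HK_cubes_one fun_eq_iff m_assoc
        HK_cubes_carrier extensional_arb[OF HK_cubes_extensional] intro: m_comm)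
next
  fix m n \<phi> assume "\<phi> \<in> box_hom m n"
  then show "restr (HK G A) m n \<phi> \<in> hom (level (HK G A) n) (level (HK G A) m)"
    using box_hom_cube[of \<phi> m n]
    using HK_cubes_restr[of \<phi> m n] by (auto simp: hom_def level_def HK_def compose_def fun_eq_iff)
qed

corollary simplicial_comm_group_Kstar_HK: "simplicial_comm_group (Kstar (HK G A))"
  by (rule simplicial_comm_group_Kstar[OF is_cubegroup_HK])

end

end

(*
  A cubeset map from K_n to a Host--Kra cubegroup is the same as a function f on the nonempty subsets
  of [n], subject to conditions indexed by the degenerable cubes. Lying in the Moore complex means that
  f vanishes on every set missing some i > 0, so f is determined by its values on {0..n} and {1..n}.

  Conversely any f with values in A_n is allowed: for sigma : [k] -> [n] and a degenerable k-cube F, the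
  map sigma_* F is independent of x_i whenever sigma i = sigma (i + 1), hence depends on at most n
  coordinates, and every A_n-valued function of at most n coordinates is a Host--Kra cube.

  Both values do lie in A_n, because there are degenerable n-cubes in [n] that hit {0..n} exactly at
  the top vertex, respectively {1..n} exactly at the top vertex and {0..n} at one adjacent vertex,
  while all other vertices miss some i > 0.
*)
theory Submission imports Defs begin

section \<open>Host--Kra cubes\<close>

context filtered_comm_group
begin

text \<open>The indicator of \<open>{i \<in> J. x i = 1} = T\<close> is the product of
  \<open>1 - x i\<close> over \<open>J - T\<close> and of \<open>x i\<close> over \<open>T\<close>,
  a polynomial of degree \<open>card J\<close>. Coefficients in \<open>A (card J)\<close> are
  therefore admissible, and the function is the product of these cubes over all
  \<open>T\<close>.\<close>

lemma HK_cubes_few_coordinates: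
  assumes J: "J \<subseteq> {..<k}" and g: "\<And>T. T \<subseteq> J \<Longrightarrow> g T \<in> A (card J)"
  shows "(\<lambda>x \<in> cube k. g {i \<in> J. x i = 1}) \<in> HK_cubes G A k"
proof -
  have fJ: "finite J" using J finite_subset by blast
  \<comment> \<open>Reflecting the cube turns each \<open>1 - x i\<close> into a pulled-back
    coordinate, so \<open>HK_cubes_affine_prod\<close> covers the mixed product.\<close>
  let ?\<phi> = "\<lambda>x \<in> cube k. \<lambda>i \<in> {..<k}. 1 - x i"
  have refl: "?\<phi> \<in> box_hom k k"
  proof -
    have "?\<phi> \<in> cube k \<rightarrow>\<^sub>E cube k" by (auto simp: cube_def PiE_iff)
    moreover have "?\<phi> x j = 1 + (\<Sum>i<k. (if i = j then - 1 else 0) * x i)"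
      if "x \<in> cube k" "j < k" for x j
    proof -
      have "(\<Sum>i<k. (if i = j then - 1 else 0) * x i) = (\<Sum>i<k. if i = j then - x i else 0)"
        by (rule sum.cong) auto
      then show ?thesis using that by simp
    qed
    ultimately show ?thesis unfolding box_hom_def mem_Collect_eq
      by (intro conjI exI[of _ "\<lambda>j i. if i = j then - 1 else 0"] exI[of _ "\<lambda>_. 1"]) auto
  qed
  have single: "(\<lambda>x \<in> cube k. if {i \<in> J. x i = 1} = T then g T else \<one>) \<in> HK_cubes G A k"
    if T: "T \<subseteq> J" for T
  proof -
    have "card (J - T) + card T = card J"
      using T fJ by (metis card_Diff_subset card_mono finite_subset le_add_diff_inverse2)
    then have "(\<lambda>x \<in> cube k. g T [^] ((\<Prod>i\<in>J - T. ?\<phi> x i) * (\<Prod>i\<in>T. x i))) \<in> HK_cubes G A k"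
      using HK_cubes_affine_prod[OF refl, of "J - T" T "g T"] T J g[OF T] fJ by auto
    moreover have "g T [^] ((\<Prod>i\<in>J - T. ?\<phi> x i) * (\<Prod>i\<in>T. x i)) =
        (if {i \<in> J. x i = 1} = T then g T else \<one>)" if x: "x \<in> cube k" for x
    proof -
      have x01: "x i = 0 \<or> x i = 1" if "i \<in> J" for i
        using x J that by (auto simp: cube_def PiE_iff)
      have "(\<Prod>i\<in>J - T. ?\<phi> x i) = (\<Prod>i\<in>J - T. 1 - x i)"
        using x J by (intro prod.cong) auto
      moreover have "(\<Prod>i\<in>J - T. 1 - x i) * (\<Prod>i\<in>T. x i) = (if {i \<in> J. x i = 1} = T then 1 else 0)"
      proof (cases "{i \<in> J. x i = 1} = T")
        case True
        have "(\<Prod>i\<in>J - T. 1 - x i) = 1" using True x01 by (intro prod.neutral) auto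
        moreover have "(\<Prod>i\<in>T. x i) = 1" using True by (intro prod.neutral) auto
        ultimately show ?thesis using True by simp
      next
        case False
        then consider i where "i \<in> J - T" "x i = 1" | i where "i \<in> T" "x i = 0"
          using T x01 by blast
        then show ?thesis
        proof cases
          case 1
          then have "(\<Prod>i\<in>J - T. 1 - x i) = 0" using fJ by (auto intro!: prod_zero bexI[of _ i])
          then show ?thesis using False by simp
        next
          case 2
          then have "(\<Prod>i\<in>T. x i) = 0" using fJ T finite_subset by (auto intro!: prod_zero)
          then show ?thesis using False by simp
        qed
      qed
      ultimately show ?thesis using A_in_carrier[OF g[OF T]] int_pow_1 by auto
    qed
    ultimately show ?thesis by (simp cong: restrict_cong)
  qed
  \<comment> \<open>The vertices \<open>T\<close> are added one at a time; for a fixed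
    \<open>x\<close> at most one factor is nontrivial.\<close>
  have "(\<lambda>x \<in> cube k. if {i \<in> J. x i = 1} \<in> \<T> then g {i \<in> J. x i = 1} else \<one>) \<in> HK_cubes G A k"
    if "finite \<T>" "\<T> \<subseteq> Pow J" for \<T>
    using that
  proof (induction \<T> rule: finite_induct)
    case empty
    then show ?case using HK_cubes_one by (simp only: empty_iff if_False)
  next
    case (insert T \<T>)
    have T: "T \<subseteq> J" "\<T> \<subseteq> Pow J" using insert.prems by auto
    have "(\<lambda>x \<in> cube k. if {i \<in> J. x i = 1} \<in> Set.insert T \<T> then g {i \<in> J. x i = 1} else \<one>) =
      (\<lambda>x \<in> cube k. (\<lambda>x \<in> cube k. if {i \<in> J. x i = 1} = T then g T else \<one>) x \<otimes>
       (\<lambda>x \<in> cube k. if {i \<in> J. x i = 1} \<in> \<T> then g {i \<in> J. x i = 1} else \<one>) x)"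
      using insert.hyps(2) A_in_carrier[OF g] by (intro restrict_ext) auto
    then show ?case using HK_cubes_mult[OF single[OF T(1)] insert.IH[OF T(2)]] by (simp only:)
  qed
  from this[of "Pow J"] fJ show ?thesis by (auto cong: restrict_cong)
qed

lemma HK_cubes_A_valued:
  assumes "\<And>x. x \<in> cube n \<Longrightarrow> h x \<in> A n"
  shows "(\<lambda>x \<in> cube n. h x) \<in> HK_cubes G A n"
proof -
  define v where "v T = (\<lambda>i \<in> {..<n}. if i \<in> T then 1 else (0 :: int))" for T :: "nat set"
  have "v T \<in> cube n" for T by (auto simp: v_def cube_def)
  then have "(\<lambda>x \<in> cube n. h (v {i \<in> {..<n}. x i = 1})) \<in> HK_cubes G A n"
    using assms by (intro HK_cubes_few_coordinates[where g = "\<lambda>T. h (v T)"]) auto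
  moreover have "v {i \<in> {..<n}. x i = 1} = x" if "x \<in> cube n" for x
    using that by (auto simp: v_def cube_def PiE_iff extensional_def fun_eq_iff)
  ultimately show ?thesis by (simp cong: restrict_cong)
qed

text \<open>Moebius inversion: by induction on \<open>S\<close>, triviality at the vertex with
  support \<open>S\<close> makes the coefficient \<open>a S\<close> trivial for every proper subset
  \<open>S\<close>. The top value is then the top coefficient.\<close>

lemma HK_cubes_top_vertex:
  assumes c: "c \<in> HK_cubes G A n"
    and 1: "\<And>x i. x \<in> cube n \<Longrightarrow> i < n \<Longrightarrow> x i = 0 \<Longrightarrow> c x = \<one>"
  shows "c (\<lambda>i \<in> {..<n}. 1) \<in> A n"
proof -
  obtain a where a: "\<And>S. S \<in> Pow {..<n} \<Longrightarrow> a S \<in> A (card S)"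
    "c = (\<lambda>x \<in> cube n. \<Otimes>S \<in> Pow {..<n}. a S [^] (\<Prod>i\<in>S. x i))"
    using c unfolding HK_cubes_def by auto
  define v where "v T = (\<lambda>i \<in> {..<n}. if i \<in> T then 1 else (0 :: int))" for T :: "nat set"
  have v: "v T \<in> cube n" for T by (auto simp: v_def cube_def)
  \<comment> \<open>At \<open>v T\<close> the monomials with \<open>S\<close> not inside
    \<open>T\<close> vanish, and those strictly below \<open>T\<close> have trivial coefficient by
    assumption.\<close>
  have val: "c (v T) = a T" if T: "T \<subseteq> {..<n}" and below: "\<And>S. S \<subset> T \<Longrightarrow> a S = \<one>" for T
  proof -
    have "c (v T) = (\<Otimes>S \<in> Pow {..<n}. if T = S then a S else \<one>)"
      unfolding a(2) restrict_apply' [OF v]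
    proof (intro finprod_cong' refl)
      fix S assume S: "S \<in> Pow {..<n}"
      have aS: "a S \<in> carrier G" using A_in_carrier[OF a(1)[OF S]] .
      consider "S = T" | "S \<subset> T" | i where "i \<in> S" "i \<notin> T" by blast
      then show "a S [^] (\<Prod>i\<in>S. v T i) = (if T = S then a S else \<one>)"
      proof cases
        case 1
        have "(\<Prod>i\<in>S. v T i) = 1" using S 1 by (intro prod.neutral) (auto simp: v_def)
        then show ?thesis using 1 aS by (simp add: int_pow_1)
      next
        case 2
        then show ?thesis using below by auto
      next
        case 3
        have "(\<Prod>i\<in>S. v T i) = 0"
          using S 3 by (intro prod_zero bexI[of _ i]) (auto simp: v_def finite_subset)
        then show ?thesis using 3 by auto
      qed
    qed (use A_in_carrier[OF a(1)] in auto)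
    also have "\<dots> = a T"
      using T A_in_carrier[OF a(1)] by (intro finprod_singleton) auto
    finally show ?thesis .
  qed
  have below: "a S = \<one>" if "S \<subset> {..<n}" for S
  proof -
    have "finite S" using that finite_subset by blast
    then show ?thesis using that
    proof (induction S rule: finite_psubset_induct)
      case (psubset S)
      obtain i where "i < n" "i \<notin> S" using psubset.prems by auto
      then have "c (v S) = \<one>" by (intro 1[OF v]) (auto simp: v_def)
      with val[of S] psubset show ?case by auto
    qed
  qed
  have "c (v {..<n}) \<in> A n" using val[of "{..<n}"] below a(1)[of "{..<n}"] by simp
  moreover have "v {..<n} = (\<lambda>i \<in> {..<n}. 1)" by (auto simp: v_def)
  ultimately show ?thesis by simp
qed

end


section \<open>Degenerable cubes\<close>

text \<open>\<open>codegen n i\<close> merges only \<open>i\<close> and \<open>Suc i\<close>. As one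
  of them is always present, toggling them is invisible after merging, so only the other elements
  must be independent of \<open>x i\<close>.\<close>

lemma degenerableI:
  assumes F: "F \<in> formal_cubes n"
    and meet: "\<And>x i. x \<in> cube n \<Longrightarrow> i < n \<Longrightarrow> i \<in> F x \<or> Suc i \<in> F x"
    and indep: "\<And>x y i j. x \<in> cube n \<Longrightarrow> y \<in> cube n \<Longrightarrow> i < n \<Longrightarrow>
      \<forall>l<n. l \<noteq> i \<longrightarrow> x l = y l \<Longrightarrow> j \<in> F x \<Longrightarrow> j \<noteq> i \<Longrightarrow> j \<noteq> Suc i \<Longrightarrow> j \<in> F y"
  shows "degenerable n F"
proof -
  have "codegen n i ` F x \<subseteq> codegen n i ` F y"
    if *: "i < n" "x \<in> cube n" "y \<in> cube n" "\<forall>l<n. l \<noteq> i \<longrightarrow> x l = y l" for i x y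
  proof
    fix s assume "s \<in> codegen n i ` F x"
    then obtain j where j: "j \<in> F x" "s = codegen n i j" by blast
    show "s \<in> codegen n i ` F y"
    proof (cases "j = i \<or> j = Suc i")
      case True
      then have "s = codegen n i i" "s = codegen n i (Suc i)"
        using j * by (auto simp: codegen_def)
      then show ?thesis using meet[OF *(3,1)] by blast
    next
      case False
      then show ?thesis using indep[OF *(2,3,1,4) j(1)] j(2) by blast
    qed
  qed
  then show ?thesis unfolding degenerable_def by (intro allI impI ballI equalityI) simp_all
qed

lemma degenerable_in_K_cubes:
  assumes "F \<in> formal_cubes n" "degenerable n F"
  shows "F \<in> K_cubes n n"
proof -
  have "(\<lambda>j \<in> {..n}. j) \<in> simplex_hom n n" by (auto simp: simplex_hom_def mono_on_def)
  moreover have "F = (\<lambda>x \<in> cube n. (\<lambda>j \<in> {..n}. j) ` F ((\<lambda>x \<in> cube n. x) x))"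
  proof
    fix x
    show "F x = (\<lambda>x \<in> cube n. (\<lambda>j \<in> {..n}. j) ` F ((\<lambda>x \<in> cube n. x) x)) x"
    proof (cases "x \<in> cube n")
      case True
      then have "F x \<subseteq> {..n}" using assms(1) by (auto simp: formal_cubes_def Sub_def PiE_iff)
      then have "(\<lambda>j \<in> {..n}. j) ` F x = id ` F x" by (intro image_cong) auto
      then show ?thesis using True by simp
    next
      case False
      then show ?thesis using assms(1) by (auto simp: formal_cubes_def PiE_iff extensional_def)
    qed
  qed
  ultimately show ?thesis using assms restrict_in_box_hom[of n] unfolding K_cubes_def by blast
qed

section \<open>Cubes detecting the sets \<open>{..n}\<close> and \<open>{1..n}\<close>\<close>

text \<open>For \<open>r = 0\<close>: remove \<open>i + 1\<close> whenever \<open>i\<close> is the last index of a maximal run of zeros, so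
  that no two adjacent elements are removed simultaneously. For \<open>r = 1\<close>, the element \<open>1\<close> is always
  kept, which allows the coordinate \<open>x\<^sub>0\<close> to toggle the element \<open>0\<close>.\<close>

definition run_cube :: "nat \<Rightarrow> nat \<Rightarrow> (nat \<Rightarrow> int) \<Rightarrow> nat set" where
  "run_cube r n = (\<lambda>x \<in> cube n. {j. j \<le> n \<and> (j = 0 \<longrightarrow> r = 0 \<or> x 0 = 0) \<and>
     (r < j \<longrightarrow> x (j - 1) = 1 \<or> j < n \<and> x j = 0)})"

text \<open>Membership of \<open>j\<close> depends at most on \<open>x (j - 1)\<close> and
  \<open>x j\<close>, so \<open>x i\<close> affects only \<open>i\<close> and \<open>Suc i\<close>.
  Moreover \<open>x i = 0\<close> keeps \<open>i\<close> and \<open>x i = 1\<close> keeps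
  \<open>Suc i\<close>.\<close>

lemma run_cube:
  assumes "0 < n" "r \<le> 1"
  shows "run_cube r n \<in> K_cubes n n"
proof -
  have meet: "i \<in> run_cube r n x \<or> Suc i \<in> run_cube r n x" if "x \<in> cube n" "i < n" for x i
  proof -
    have "x i = 0 \<or> x i = 1" using that by (auto simp: cube_def PiE_iff)
    then show ?thesis using that assms by (cases i) (auto simp: run_cube_def)
  qed
  have "run_cube r n x \<in> Sub n" if "x \<in> cube n" for x
    using that meet[OF that \<open>0 < n\<close>] by (auto simp: Sub_def run_cube_def)
  then have F: "run_cube r n \<in> formal_cubes n"
    by (auto simp: formal_cubes_def PiE_iff) (auto simp: run_cube_def)
  have "degenerable n (run_cube r n)"
  proof (rule degenerableI[OF F meet])
    fix x y :: "nat \<Rightarrow> int" and i j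
    assume *: "x \<in> cube n" "y \<in> cube n" "i < n" "\<forall>l<n. l \<noteq> i \<longrightarrow> x l = y l"
      "j \<in> run_cube r n x" "j \<noteq> i" "j \<noteq> Suc i"
    then have "j < n \<longrightarrow> x j = y j" "0 < j \<longrightarrow> j \<le> n \<longrightarrow> x (j - 1) = y (j - 1)" by auto
    with * show "j \<in> run_cube r n y" using assms(1) by (auto simp: run_cube_def)
  qed auto
  then show ?thesis by (rule degenerable_in_K_cubes[OF F])
qed

lemma run_cube_top: "run_cube 0 n (\<lambda>i \<in> {..<n}. 1) = {..n}"
  "0 < n \<Longrightarrow> run_cube 1 n (\<lambda>i \<in> {..<n}. 1) = {1..n}"
  by (auto simp: run_cube_def cube_def)

lemma run_cube_side:
  assumes "x \<in> cube n" "x 0 = 0" "\<And>i. 0 < i \<Longrightarrow> i < n \<Longrightarrow> x i = 1"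
  shows "run_cube 1 n x = {..n}"
proof -
  have "x (j - 1) = 1" if "j \<le> n" "1 < j" for j using assms(3)[of "j - 1"] that by auto
  then show ?thesis using assms by (auto simp: run_cube_def)
qed

text \<open>The last zero \<open>m\<close> ends a run, so \<open>Suc m\<close> is removed. The bound
  \<open>r \<le> i\<close> matters for \<open>r = 1\<close>: if the only zero is at coordinate
  \<open>0\<close>, nothing is removed, as \<open>run_cube_side\<close> shows.\<close>

lemma run_cube_misses:
  assumes x: "x \<in> cube n" and i: "r \<le> i" "i < n" "x i = 0"
  shows "\<exists>j \<in> {1..n}. j \<notin> run_cube r n x"
proof -
  define m where "m = Max {i. i < n \<and> x i = 0}"
  have "m \<in> {i. i < n \<and> x i = 0}" unfolding m_def using i by (intro Max_in) auto
  then have m: "m < n" "x m = 0" by auto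
  have le: "l \<le> m" if "l < n" "x l = 0" for l
    unfolding m_def using that by (intro Max_ge) auto
  have "Suc m \<notin> run_cube r n x"
    using x m le[of "Suc m"] le[OF i(2,3)] i(1) by (auto simp: run_cube_def)
  then show ?thesis using m by (intro bexI[of _ "Suc m"]) auto
qed

section \<open>Pushing degenerable cubes forward along simplicial maps\<close>

text \<open>At a strict ascent the value lies below a later value, hence below \<open>n\<close>, and
  distinct ascents have distinct values.\<close>

lemma simplex_hom_ascents:
  assumes \<sigma>: "\<sigma> \<in> simplex_hom k n"
  shows "card {i. i < k \<and> \<sigma> i \<noteq> \<sigma> (Suc i)} \<le> n"
proof -
  have mono: "\<sigma> i \<le> \<sigma> j" if "i \<le> j" "j \<le> k" for i j
    using \<sigma> that by (auto simp: simplex_hom_def mono_on_def)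
  have "inj_on \<sigma> {i. i < k \<and> \<sigma> i \<noteq> \<sigma> (Suc i)}"
  proof (rule linorder_inj_onI)
    fix i j assume "i < j" and i: "i \<in> {i. i < k \<and> \<sigma> i \<noteq> \<sigma> (Suc i)}"
      and j: "j \<in> {i. i < k \<and> \<sigma> i \<noteq> \<sigma> (Suc i)}"
    then show "\<sigma> i \<noteq> \<sigma> j" using mono[of i "Suc i"] mono[of "Suc i" j] by auto
  qed auto
  moreover have "\<sigma> ` {i. i < k \<and> \<sigma> i \<noteq> \<sigma> (Suc i)} \<subseteq> {..<n}"
  proof (rule image_subsetI)
    fix i assume i: "i \<in> {i. i < k \<and> \<sigma> i \<noteq> \<sigma> (Suc i)}"
    then have "Suc i \<in> {..k}" by simp
    then have "\<sigma> (Suc i) \<le> n" using \<sigma> unfolding simplex_hom_def PiE_iff by blast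
    then show "\<sigma> i \<in> {..<n}" using i mono[of i "Suc i"] by auto
  qed
  ultimately show ?thesis using card_inj_on_le[of \<sigma> _ "{..<n}"] by fastforce
qed

text \<open>Where \<open>\<sigma> i = \<sigma> (Suc i)\<close>, the map \<open>\<sigma>\<close>
  factors through \<open>codegen k i\<close>, so degenerability removes the dependence on
  \<open>x i\<close>. Changing such coordinates one by one leads from \<open>x\<close> to
  \<open>y\<close>.\<close>

lemma degenerable_image_cong:
  assumes F: "F \<in> formal_cubes k" "degenerable k F" and \<sigma>: "\<sigma> \<in> simplex_hom k n"
    and x: "x \<in> cube k" "y \<in> cube k"
    and eq: "\<And>i. i < k \<Longrightarrow> \<sigma> i \<noteq> \<sigma> (Suc i) \<Longrightarrow> x i = y i"
  shows "\<sigma> ` F x = \<sigma> ` F y"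
proof -
  have sub: "F z \<subseteq> {..k}" if "z \<in> cube k" for z
    using F that by (auto simp: formal_cubes_def Sub_def PiE_iff)
  have step: "\<sigma> ` F z = \<sigma> ` F w"
    if zw: "z \<in> cube k" "w \<in> cube k" "i < k" "\<sigma> i = \<sigma> (Suc i)" "\<forall>l<k. l \<noteq> i \<longrightarrow> z l = w l" for z w i
  proof -
    \<comment> \<open>The factorization is \<open>\<sigma> = \<tau> \<circ> codegen k i\<close>;
      beyond \<open>i\<close> the index shifts by one.\<close>
    define \<tau> where "\<tau> j = (if j \<le> i then \<sigma> j else \<sigma> (Suc j))" for j
    have \<tau>: "\<tau> (codegen k i j) = \<sigma> j" if "j \<le> k" for j
      using that zw(4) by (cases "j = Suc i") (auto simp: \<tau>_def codegen_def)
    have "\<sigma> ` F z = \<tau> ` codegen k i ` F z" if "z \<in> cube k" for z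
      using \<tau> sub[OF that] by (subst image_image) (intro image_cong, auto)
    moreover have "codegen k i ` F z = codegen k i ` F w"
      using F(2) zw(1-3,5) unfolding degenerable_def by blast
    ultimately show ?thesis using zw(1,2) by simp
  qed
  \<comment> \<open>A path of vertices: \<open>h l\<close> has its first \<open>l\<close>
    coordinates from \<open>y\<close> and the rest from \<open>x\<close>.\<close>
  define h where "h l = (\<lambda>i \<in> {..<k}. if i < l then y i else x i)" for l
  have h: "h l \<in> cube k" for l using x by (auto simp: h_def cube_def PiE_iff)
  have "l \<le> k \<Longrightarrow> \<sigma> ` F (h l) = \<sigma> ` F (h 0)" for l
  proof (induction l)
    case (Suc l)
    have "\<sigma> ` F (h (Suc l)) = \<sigma> ` F (h l)"
    proof (cases "\<sigma> l = \<sigma> (Suc l)")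
      case True
      then show ?thesis using Suc.prems by (intro step[OF h h, of l]) (auto simp: h_def)
    next
      case False
      then have "h (Suc l) = h l" using eq[of l] Suc.prems by (auto simp: h_def less_Suc_eq)
      then show ?thesis by simp
    qed
    then show ?case using Suc by simp
  qed simp
  moreover have "h 0 = x" "h k = y"
    using x by (auto simp: h_def cube_def PiE_iff extensional_def fun_eq_iff)
  ultimately show ?thesis by (metis order_refl)
qed


section \<open>Maps out of K as functions on subsets\<close>

text \<open>The only element of \<open>cube 0\<close> is the function that is \<open>undefined\<close> everywhere.\<close>

definition point_value :: "(nat \<Rightarrow> ((nat \<Rightarrow> int) \<Rightarrow> nat set) \<Rightarrow> (nat \<Rightarrow> int) \<Rightarrow> 'a) \<Rightarrow> nat set \<Rightarrow> 'a" where
  "point_value \<eta> S = \<eta> 0 (\<lambda>x \<in> cube 0. S) (\<lambda>_. undefined)"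

definition point_map ::
    "nat \<Rightarrow> (nat set \<Rightarrow> 'a) \<Rightarrow> nat \<Rightarrow> ((nat \<Rightarrow> int) \<Rightarrow> nat set) \<Rightarrow> (nat \<Rightarrow> int) \<Rightarrow> 'a" where
  "point_map n f = (\<lambda>m. \<lambda>c \<in> K_cubes n m. \<lambda>x \<in> cube m. f (c x))"

lemma undefined_in_cube_0: "(\<lambda>_. undefined) \<in> cube 0"
  by (simp add: cube_def)

lemma K_cubes_Sub: "c \<in> K_cubes n m \<Longrightarrow> x \<in> cube m \<Longrightarrow> c x \<in> Sub n"
  using K_cubes_image_subset[of c n m x]
  by (fastforce simp: K_cubes_def Sub_def formal_cubes_def PiE_iff dest: box_hom_cube)

lemma simplex_hom_Sub: "\<sigma> \<in> simplex_hom k n \<Longrightarrow> S \<in> Sub k \<Longrightarrow> \<sigma> ` S \<in> Sub n"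
  by (auto simp: simplex_hom_def Sub_def PiE_iff)

text \<open>For \<open>m = 0\<close> this makes every element of \<open>Sub n\<close> a point of
  \<open>K n\<close>, so that \<open>point_value\<close> evaluates \<open>\<eta>\<close> inside its
  domain.\<close>

lemma const_in_K_cubes:
  assumes S: "S \<in> Sub n"
  shows "(\<lambda>x \<in> cube m. S) \<in> K_cubes n m"
proof -
  have "(\<lambda>x \<in> cube n. S) \<in> K_cubes n n"
    using S by (intro degenerable_in_K_cubes) (auto simp: formal_cubes_def degenerable_def)
  moreover have 0: "(\<lambda>x \<in> cube m. \<lambda>i \<in> {..<n}. 0) \<in> box_hom m n"
    unfolding box_hom_def mem_Collect_eq
    by (intro conjI exI[of _ "\<lambda>_ _. 0"] exI[of _ "\<lambda>_. 0"]) (auto simp: cube_def)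
  ultimately have "compose (cube m) (\<lambda>x \<in> cube n. S) (\<lambda>x \<in> cube m. \<lambda>i \<in> {..<n}. 0) \<in> K_cubes n m"
    by (rule K_cubes_restr)
  moreover have "compose (cube m) (\<lambda>x \<in> cube n. S) (\<lambda>x \<in> cube m. \<lambda>i \<in> {..<n}. 0) = (\<lambda>x \<in> cube m. S)"
    using box_hom_cube[OF 0] by (auto simp: compose_def fun_eq_iff)
  ultimately show ?thesis by simp
qed

text \<open>Naturality along the inclusion of the vertex \<open>x\<close>, a morphism from
  \<open>cube 0\<close> to \<open>cube m\<close>.\<close>

lemma cubeset_hom_point_value:
  assumes \<eta>: "\<eta> \<in> cubeset_hom (K n) (HK G A)" and c: "c \<in> K_cubes n m" and x: "x \<in> cube m"
  shows "\<eta> m c x = point_value \<eta> (c x)"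
proof -
  let ?\<phi> = "\<lambda>_ \<in> cube 0. x"
  have \<phi>: "?\<phi> \<in> box_hom 0 m"
    using x unfolding box_hom_def mem_Collect_eq
    by (intro conjI exI[of _ "\<lambda>_ _. 0"] exI[of _ x]) auto
  have "\<eta> 0 (compose (cube 0) c ?\<phi>) = compose (cube 0) (\<eta> m c) ?\<phi>"
    using \<eta> \<phi> c by (auto simp: cubeset_hom_def K_def HK_def)
  moreover have "compose (cube 0) c ?\<phi> = (\<lambda>_ \<in> cube 0. c x)"
    by (auto simp: compose_def fun_eq_iff)
  ultimately show ?thesis by (simp add: point_value_def compose_def undefined_in_cube_0)
qed

lemma cubeset_hom_HK_cubes:
  "\<eta> \<in> cubeset_hom (K n) (HK G A) \<Longrightarrow> c \<in> K_cubes n m \<Longrightarrow> \<eta> m c \<in> HK_cubes G A m"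
  by (auto simp: cubeset_hom_def K_def HK_def PiE_iff)

lemma point_value_point_map: "S \<in> Sub n \<Longrightarrow> point_value (point_map n f) S = f S"
  by (simp add: point_value_def point_map_def const_in_K_cubes undefined_in_cube_0)

lemma point_value_spull:
  assumes "S \<in> Sub k"
  shows "point_value (spull (Kstar (HK G A)) k n \<sigma> \<eta>) S = point_value \<eta> (\<sigma> ` S)"
  using const_in_K_cubes[OF assms, of 0]
  by (simp add: point_value_def Kstar_def K_def K_push_def cong: restrict_cong)

section \<open>Cubeset maps into a Host-Kra cubegroup\<close>

context filtered_comm_group
begin

text \<open>A Host-Kra cube is a function on vertices, and its value at each vertex is a point
  value.\<close>

lemma cubeset_hom_eqI:
  assumes \<eta>: "\<eta> \<in> cubeset_hom (K n) (HK G A)" and \<theta>: "\<theta> \<in> cubeset_hom (K n) (HK G A)"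
    and eq: "\<And>S. S \<in> Sub n \<Longrightarrow> point_value \<eta> S = point_value \<theta> S"
  shows "\<eta> = \<theta>"
proof (intro ext)
  fix m c x
  show "\<eta> m c x = \<theta> m c x"
  proof (cases "c \<in> K_cubes n m")
    case True
    show ?thesis
    proof (cases "x \<in> cube m")
      case True
      then show ?thesis using \<open>c \<in> K_cubes n m\<close> K_cubes_Sub
        by (simp add: cubeset_hom_point_value[OF \<eta>] cubeset_hom_point_value[OF \<theta>] eq)
    next
      case False
      with \<open>c \<in> K_cubes n m\<close> show ?thesis
        using HK_cubes_extensional cubeset_hom_HK_cubes[OF \<eta>] cubeset_hom_HK_cubes[OF \<theta>]
        by (metis extensional_arb)
    qed
  next
    case False
    then show ?thesis using \<eta> \<theta> by (auto simp: cubeset_hom_def K_def PiE_iff extensional_def)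
  qed
qed

lemma point_value_carrier:
  "\<eta> \<in> cubeset_hom (K n) (HK G A) \<Longrightarrow> S \<in> Sub n \<Longrightarrow> point_value \<eta> S \<in> carrier G"
  unfolding point_value_def
  using HK_cubes_carrier[OF cubeset_hom_HK_cubes[OF _ const_in_K_cubes] undefined_in_cube_0] .

lemma point_map_in_hom:
  assumes f: "\<And>S. S \<in> Sub n \<Longrightarrow> f S \<in> A n"
  shows "point_map n f \<in> cubeset_hom (K n) (HK G A)"
proof -
  have 1: "(\<lambda>x \<in> cube m. f (c x)) \<in> HK_cubes G A m" if c: "c \<in> K_cubes n m" for m c
  proof -
    obtain k \<phi> F \<sigma> where *: "\<phi> \<in> box_hom m k" "F \<in> formal_cubes k" "\<sigma> \<in> simplex_hom k n"
      "degenerable k F" "c = (\<lambda>x \<in> cube m. \<sigma> ` F (\<phi> x))"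
      using c unfolding K_cubes_def by blast
    \<comment> \<open>The strict ascents are the only coordinates on which the pushed cube depends.
      There are at most \<open>n\<close> of them, so values in \<open>A n\<close> lie in
      \<open>A (card J)\<close>.\<close>
    define J where "J = {i. i < k \<and> \<sigma> i \<noteq> \<sigma> (Suc i)}"
    define v where "v T = (\<lambda>i \<in> {..<k}. if i \<in> T then 1 else (0 :: int))" for T :: "nat set"
    have v: "v T \<in> cube k" for T by (auto simp: v_def cube_def)
    have Sub: "\<sigma> ` F x \<in> Sub n" if "x \<in> cube k" for x
      using *(2) that by (intro simplex_hom_Sub[OF *(3)]) (auto simp: formal_cubes_def PiE_iff)
    have "f (\<sigma> ` F (v T)) \<in> A (card J)" for T
      using f[OF Sub[OF v]] A_antimono[OF simplex_hom_ascents[OF *(3)]] by (auto simp: J_def)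
    then have "(\<lambda>x \<in> cube k. f (\<sigma> ` F (v {i \<in> J. x i = 1}))) \<in> HK_cubes G A k"
      by (intro HK_cubes_few_coordinates[where g = "\<lambda>T. f (\<sigma> ` F (v T))"]) (auto simp: J_def)
    moreover have "\<sigma> ` F (v {i \<in> J. x i = 1}) = \<sigma> ` F x" if "x \<in> cube k" for x
      using that by (intro degenerable_image_cong[OF *(2,4,3) v that])
        (auto simp: v_def J_def cube_def PiE_iff)
    ultimately have "(\<lambda>x \<in> cube k. f (\<sigma> ` F x)) \<in> HK_cubes G A k"
      by (simp cong: restrict_cong)
    from HK_cubes_restr[OF *(1) this]
    have "compose (cube m) (\<lambda>x \<in> cube k. f (\<sigma> ` F x)) \<phi> \<in> HK_cubes G A m" .
    moreover have "compose (cube m) (\<lambda>x \<in> cube k. f (\<sigma> ` F x)) \<phi> = (\<lambda>x \<in> cube m. f (c x))"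
      using box_hom_cube[OF *(1)] by (auto simp: compose_def *(5) fun_eq_iff)
    ultimately show ?thesis by simp
  qed
  have 2: "(\<lambda>x \<in> cube m. f (compose (cube m) c \<phi> x)) =
      compose (cube m) (\<lambda>x \<in> cube l. f (c x)) \<phi>" if "\<phi> \<in> box_hom m l" for m l \<phi> c
    using box_hom_cube[OF that] by (auto simp: compose_def fun_eq_iff)
  show ?thesis
    by (rule cubeset_homI) (auto simp: point_map_def K_def HK_def 1 2 K_cubes_restr)
qed

text \<open>The top-vertex criterion is applied to the images of the two run cubes. The full set
  comes first, since the correction for \<open>{1..n}\<close> needs its value to lie in
  \<open>A n\<close>.\<close>

lemma hom_values_in_A:
  assumes \<eta>: "\<eta> \<in> cubeset_hom (K n) (HK G A)" and n: "0 < n"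
    and van: "\<And>S i. S \<in> Sub n \<Longrightarrow> i \<in> {1..n} \<Longrightarrow> i \<notin> S \<Longrightarrow> point_value \<eta> S = \<one>"
  shows "point_value \<eta> {..n} \<in> A n" "point_value \<eta> {1..n} \<in> A n"
proof -
  let ?t = "\<lambda>i \<in> {..<n}. (1 :: int)"
  have t: "?t \<in> cube n" by (auto simp: cube_def)
  define c where "c r = \<eta> n (run_cube r n)" for r
  have c: "c r \<in> HK_cubes G A n" if "r \<le> 1" for r
    unfolding c_def using cubeset_hom_HK_cubes[OF \<eta> run_cube[OF n that]] .
  have cx: "c r x = point_value \<eta> (run_cube r n x)" if "r \<le> 1" "x \<in> cube n" for r x
    unfolding c_def using cubeset_hom_point_value[OF \<eta> run_cube[OF n that(1)] that(2)] .
  have c1: "c r x = \<one>" if *: "r \<le> 1" "x \<in> cube n" "r \<le> i" "i < n" "x i = 0" for r x i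
  proof -
    obtain j where "j \<in> {1..n}" "j \<notin> run_cube r n x" using run_cube_misses[OF *(2-5)] by blast
    then show ?thesis using van[OF K_cubes_Sub[OF run_cube[OF n *(1)] *(2)]] cx[OF *(1,2)]
      by simp
  qed
  \<comment> \<open>For \<open>r = 0\<close> any zero coordinate already forces a trivial
    value.\<close>
  have "c 0 ?t \<in> A n" using HK_cubes_top_vertex[OF c] c1[of 0] by simp
  then show a: "point_value \<eta> {..n} \<in> A n" using cx[OF _ t, of 0] by (simp add: run_cube_top)
  let ?a = "point_value \<eta> {..n}"
  \<comment> \<open>\<open>h\<close> cancels the value of \<open>c 1\<close> at the vertex \<open>(0, 1, \<dots>, 1)\<close>, leaving only the top vertex.\<close>
  define h where "h x = (if x = ?t then \<one> else if \<forall>i. 0 < i \<and> i < n \<longrightarrow> x i = 1 then inv ?a else \<one>)"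
    for x
  have "h x \<in> A n" for x
    using subgroup.one_closed[OF A_subgroup] subgroup.m_inv_closed[OF A_subgroup a]
    by (auto simp: h_def)
  then have h: "(\<lambda>x \<in> cube n. h x) \<in> HK_cubes G A n" by (rule HK_cubes_A_valued)
  let ?e = "\<lambda>x \<in> cube n. c 1 x \<otimes> (\<lambda>x \<in> cube n. h x) x"
  have "?e ?t \<in> A n"
  proof (rule HK_cubes_top_vertex[OF HK_cubes_mult[OF c h]])
    fix x i assume x: "x \<in> cube n" and i: "i < n" "x i = 0"
    then have xt: "x \<noteq> ?t" by auto
    show "?e x = \<one>"
    \<comment> \<open>A non-top vertex either is \<open>(0, 1, ..., 1)\<close>, where
      \<open>c 1\<close> has value \<open>?a\<close> and \<open>h\<close> cancels it, or has a zero
      at a positive coordinate, where both factors are trivial.\<close>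
    proof (cases "\<forall>i. 0 < i \<and> i < n \<longrightarrow> x i = 1")
      case True
      then have "x 0 = 0" using i by (cases "i = 0") auto
      then have "c 1 x = ?a" using cx[of 1 x] x run_cube_side[OF x] True by simp
      then show ?thesis using xt True x A_in_carrier[OF a] by (simp add: h_def)
    next
      case False
      then obtain j where "0 < j" "j < n" "x j = 0" using x by (auto simp: cube_def PiE_iff)
      then have "c 1 x = \<one>" using c1[of 1 x j] x by simp
      then show ?thesis using xt False x unfolding h_def by (simp only: restrict_apply' if_False l_one one_closed)
    qed
  qed simp
  moreover have "?e ?t = c 1 ?t" using t HK_cubes_carrier[OF c t] by (simp add: h_def)
  ultimately show "point_value \<eta> {1..n} \<in> A n" using cx[OF _ t, of 1] run_cube_top(2)[OF n] by simp
qed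

section \<open>The normalized Moore complex in terms of values on subsets\<close>

lemma point_value_mult:
  "S \<in> Sub n \<Longrightarrow> point_value (\<eta> \<otimes>\<^bsub>sgroup (Kstar (HK G A)) n\<^esub> \<theta>) S = point_value \<eta> S \<otimes> point_value \<theta> S"
  by (simp add: point_value_def Kstar_def K_def HK_def const_in_K_cubes undefined_in_cube_0)

lemma point_value_one:
  "S \<in> Sub n \<Longrightarrow> point_value \<one>\<^bsub>sgroup (Kstar (HK G A)) n\<^esub> S = \<one>"
  by (simp add: point_value_def Kstar_def K_def HK_def const_in_K_cubes undefined_in_cube_0)

lemma Kstar_carrier: "carrier (sgroup (Kstar (HK G A)) n) = cubeset_hom (K n) (HK G A)"
  by (simp add: Kstar_def)

text \<open>The face at \<open>i\<close> precomposes point values with direct image along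
  \<open>coface n i\<close>, and these direct images are exactly the nonempty sets missing
  \<open>i\<close>.\<close>

lemma moore_carrier:
  "carrier (moore_group (Kstar (HK G A)) n) = {\<eta> \<in> cubeset_hom (K n) (HK G A).
     \<forall>S \<in> Sub n. \<forall>i \<in> {1..n}. i \<notin> S \<longrightarrow> point_value \<eta> S = \<one>}" (is "?N = ?M")
proof -
  let ?X = "Kstar (HK G A)"
  have X: "simplicial_comm_group ?X" by (rule simplicial_comm_group_Kstar_HK)
  have "face ?X n i \<eta> = \<one>\<^bsub>sgroup ?X (n - 1)\<^esub> \<longleftrightarrow> (\<forall>S \<in> Sub n. i \<notin> S \<longrightarrow> point_value \<eta> S = \<one>)"
    if \<eta>: "\<eta> \<in> cubeset_hom (K n) (HK G A)" and i: "i \<in> {1..n}" for \<eta> i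
  proof -
    have \<delta>: "coface n i \<in> simplex_hom (n - 1) n" using coface_in_simplex_hom[of "n - 1" i] i by simp
    have fh: "face ?X n i \<eta> \<in> cubeset_hom (K (n - 1)) (HK G A)"
    proof -
      have "face ?X n i \<in> hom (sgroup ?X n) (sgroup ?X (n - 1))"
        using X \<delta> unfolding simplicial_comm_group_def face_def by blast
      then show ?thesis using \<eta> unfolding Kstar_carrier[symmetric] by (rule hom_carrier[THEN subsetD, OF _ imageI])
    qed
    have oh: "\<one>\<^bsub>sgroup ?X (n - 1)\<^esub> \<in> cubeset_hom (K (n - 1)) (HK G A)"
      using X unfolding simplicial_comm_group_def Kstar_carrier[symmetric]
      by (meson comm_group.axioms(2) group.is_monoid monoid.one_closed)
    have "face ?X n i \<eta> = \<one>\<^bsub>sgroup ?X (n - 1)\<^esub> \<longleftrightarrow>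
        (\<forall>S \<in> Sub (n - 1). point_value (face ?X n i \<eta>) S = \<one>)"
      using cubeset_hom_eqI[OF fh oh] point_value_one by auto
    also have "\<dots> \<longleftrightarrow> (\<forall>S \<in> Sub (n - 1). point_value \<eta> (coface n i ` S) = \<one>)"
      unfolding face_def by (simp add: point_value_spull)
    also have "\<dots> \<longleftrightarrow> (\<forall>S \<in> (`) (coface n i) ` Sub (n - 1). point_value \<eta> S = \<one>)" by simp
    \<comment> \<open>The coface maps \<open>{..n - 1}\<close> onto \<open>{..n}\<close> without
      \<open>i\<close>, so each set missing \<open>i\<close> is the image of its preimage.\<close>
    also have "(`) (coface n i) ` Sub (n - 1) = {S \<in> Sub n. i \<notin> S}"
    proof (intro equalityI subsetI)
      fix S assume "S \<in> (`) (coface n i) ` Sub (n - 1)"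
      then obtain T where T: "T \<in> Sub (n - 1)" "S = coface n i ` T" by blast
      have "coface n i j \<noteq> i" if "j \<in> T" for j
        using that T(1) by (auto simp: coface_def Sub_def)
      then show "S \<in> {S \<in> Sub n. i \<notin> S}"
        using simplex_hom_Sub[OF \<delta> T(1)] T(2) by fastforce
    next
      fix S assume S: "S \<in> {S \<in> Sub n. i \<notin> S}"
      have ran: "\<exists>j \<le> n - 1. coface n i j = s" if "s \<in> S" for s
      proof (cases "s < i")
        case True
        then show ?thesis using i by (intro exI[of _ s]) (auto simp: coface_def)
      next
        case False
        then have "i < s" "s \<le> n" using S that by (auto simp: Sub_def intro: le_neq_trans)
        then show ?thesis by (intro exI[of _ "s - 1"]) (auto simp: coface_def)
      qed
      then have S_eq: "S = coface n i ` {j. j \<le> n - 1 \<and> coface n i j \<in> S}" by blast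
      from this have "{j. j \<le> n - 1 \<and> coface n i j \<in> S} \<in> Sub (n - 1)"
        using S by (auto simp: Sub_def)
      then show "S \<in> (`) (coface n i) ` Sub (n - 1)" using S_eq by (intro image_eqI)
    qed
    finally show ?thesis by auto
  qed
  then show ?thesis by (fastforce simp: moore_group_def Kstar_carrier)
qed

text \<open>Only sets containing \<open>{1..n}\<close> can carry a nontrivial value, which leaves
  \<open>{..n}\<close> and \<open>{1..n}\<close>. For \<open>n = 0\<close> the latter is empty and
  not in \<open>Sub 0\<close>, hence the guard.\<close>

lemma moore_eqI:
  assumes \<eta>: "\<eta> \<in> carrier (moore_group (Kstar (HK G A)) n)"
    and \<theta>: "\<theta> \<in> carrier (moore_group (Kstar (HK G A)) n)"
    and full: "point_value \<eta> {..n} = point_value \<theta> {..n}"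
    and rest: "0 < n \<Longrightarrow> point_value \<eta> {1..n} = point_value \<theta> {1..n}"
  shows "\<eta> = \<theta>"
proof (rule cubeset_hom_eqI)
  fix S assume S: "S \<in> Sub n"
  show "point_value \<eta> S = point_value \<theta> S"
  proof (cases "{1..n} \<subseteq> S")
    case True
    then have "S = {..n} \<or> 0 < n \<and> S = {1..n}"
    proof (cases "0 \<in> S")
      case False
      then have "S = {1..n}" using True S by (fastforce simp: Sub_def Suc_le_eq intro: gr0I)
      then show ?thesis using S by (auto simp: Sub_def)
    next
      case zero: True
      have "{..n} = Set.insert 0 {1..n}" by auto
      then show ?thesis using True zero S by (auto simp: Sub_def)
    qed
    then show ?thesis using full rest by auto
  next
    case False
    then show ?thesis using \<eta> \<theta> S by (fastforce simp: moore_carrier)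
  qed
qed (use \<eta> \<theta> in \<open>auto simp: moore_carrier\<close>)

text \<open>A function supported on the two sets extends to \<open>K n\<close> by
  \<open>point_map_in_hom\<close>, and both sets contain every \<open>i > 0\<close>, so the Moore
  condition holds.\<close>

lemma moore_surj:
  assumes a: "a \<in> A n" and b: "b \<in> A n"
  shows "\<exists>\<eta> \<in> carrier (moore_group (Kstar (HK G A)) n).
    point_value \<eta> {..n} = a \<and> (0 < n \<longrightarrow> point_value \<eta> {1..n} = b)"
proof -
  define f where "f S = (if S = {..n} then a else if S = {1..n} then b else \<one>)" for S
  have "f S \<in> A n" for S using a b subgroup.one_closed[OF A_subgroup] by (simp add: f_def)
  then have "point_map n f \<in> cubeset_hom (K n) (HK G A)" by (rule point_map_in_hom)
  moreover have "f S = \<one>" if "i \<in> {1..n}" "i \<notin> S" for S i using that by (auto simp: f_def)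
  ultimately have "point_map n f \<in> carrier (moore_group (Kstar (HK G A)) n)"
    by (auto simp: moore_carrier point_value_point_map)
  moreover have "point_value (point_map n f) {..n} = a"
    by (subst point_value_point_map) (auto simp: Sub_def f_def)
  moreover have "point_value (point_map n f) {1..n} = b" if "0 < n"
  proof -
    have "0 \<in> {..n}" "0 \<notin> {1..n}" by auto
    then have "{1..n} \<noteq> {..n}" by metis
    then show ?thesis using that by (subst point_value_point_map) (auto simp: Sub_def f_def)
  qed
  ultimately show ?thesis by blast
qed

lemma moore_mult:
  "S \<in> Sub n \<Longrightarrow>
    point_value (\<eta> \<otimes>\<^bsub>moore_group (Kstar (HK G A)) n\<^esub> \<theta>) S = point_value \<eta> S \<otimes> point_value \<theta> S"
  by (simp add: moore_group_def point_value_mult)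

lemma moore_iso_0:
  "(\<lambda>\<eta>. point_value \<eta> {..0}) \<in> iso (moore_group (Kstar (HK G A)) 0) (G\<lparr>carrier := A 0\<rparr>)"
proof -
  have S: "{..0} \<in> Sub 0" by (auto simp: Sub_def)
  show ?thesis
    unfolding iso_def hom_def bij_betw_def mem_Collect_eq
  proof (intro conjI)
    show "inj_on (\<lambda>\<eta>. point_value \<eta> {..0}) (carrier (moore_group (Kstar (HK G A)) 0))"
      by (rule inj_onI, rule moore_eqI) auto
    have m: "point_value \<eta> {..0} \<in> A 0" if "\<eta> \<in> carrier (moore_group (Kstar (HK G A)) 0)" for \<eta>
      using that point_value_carrier[OF _ S] by (simp add: moore_carrier A_0)
    show "(\<lambda>\<eta>. point_value \<eta> {..0}) ` carrier (moore_group (Kstar (HK G A)) 0) =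
        carrier (G\<lparr>carrier := A 0\<rparr>)"
    proof (intro equalityI subsetI)
      fix a assume "a \<in> carrier (G\<lparr>carrier := A 0\<rparr>)"
      \<comment> \<open>Degree 0 has a single copy; the second argument of \<open>moore_surj\<close>
        is a dummy.\<close>
      then show "a \<in> (\<lambda>\<eta>. point_value \<eta> {..0}) ` carrier (moore_group (Kstar (HK G A)) 0)"
        using moore_surj[of a 0 a] by auto
    qed (use m in auto)
    show "(\<lambda>\<eta>. point_value \<eta> {..0}) \<in>
        carrier (moore_group (Kstar (HK G A)) 0) \<rightarrow> carrier (G\<lparr>carrier := A 0\<rparr>)"
      using m by auto
  qed (use moore_mult[OF S] in auto)
qed

lemma moore_iso_pos:
  assumes n: "0 < n"
  shows "(\<lambda>\<eta>. (point_value \<eta> {..n}, point_value \<eta> {1..n})) \<in>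
    iso (moore_group (Kstar (HK G A)) n) (G\<lparr>carrier := A n\<rparr> \<times>\<times> G\<lparr>carrier := A n\<rparr>)"
    (is "?f \<in> iso ?N ?P")
proof -
  have S: "{..n} \<in> Sub n" "{1..n} \<in> Sub n" using n by (auto simp: Sub_def)
  have m: "?f \<eta> \<in> A n \<times> A n" if "\<eta> \<in> carrier ?N" for \<eta>
    using that hom_values_in_A[OF _ n, of \<eta>] unfolding moore_carrier by blast
  show ?thesis
    unfolding iso_def hom_def bij_betw_def mem_Collect_eq
  proof (intro conjI)
    show "inj_on ?f (carrier ?N)" by (rule inj_onI, rule moore_eqI) auto
    show "?f ` carrier ?N = carrier ?P"
    proof (intro equalityI subsetI)
      fix p assume "p \<in> carrier ?P"
      then obtain a b where p: "p = (a, b)" "a \<in> A n" "b \<in> A n" by (auto simp: DirProd_def)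
      then show "p \<in> ?f ` carrier ?N" using moore_surj[of a n b] n by force
    qed (use m in \<open>auto simp: DirProd_def\<close>)
    show "?f \<in> carrier ?N \<rightarrow> carrier ?P" using m by (auto simp: DirProd_def)
  qed (use S in \<open>simp add: moore_mult DirProd_def\<close>)
qed

lemma point_value_moore_diff:
  assumes "S \<in> Sub n"
  shows "point_value (moore_diff (Kstar (HK G A)) n \<eta>) S = point_value \<eta> (Suc ` S)"
proof -
  have "coface (Suc n) 0 ` S = Suc ` S"
    using assms by (intro image_cong) (auto simp: coface_def Sub_def)
  then show ?thesis using assms by (simp add: moore_diff_def face_def point_value_spull)
qed

end

section \<open>The differential in the coordinates given by the two values\<close>

theorem mainTheorem7:
  fixes G :: "('a, 'z) monoid_scheme" and A :: "nat \<Rightarrow> 'a set"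
  assumes "filtered_comm_group G A"
  defines "N \<equiv> moore_group (Kstar (HK G A))"
    and "d \<equiv> moore_diff (Kstar (HK G A))"
    and "GA \<equiv> (\<lambda>n. G\<lparr>carrier := A n\<rparr>)"
  shows "\<exists>f0 f.
      f0 \<in> iso (N 0) (GA 0) \<and>
      (\<forall>n\<ge>1. f n \<in> iso (N n) (GA n \<times>\<times> GA n)) \<and>
      (\<forall>x \<in> carrier (N 1). \<forall>a b. f 1 x = (a, b) \<longrightarrow> f0 (d 0 x) = b) \<and>
      (\<forall>n\<ge>1. \<forall>x \<in> carrier (N (Suc n)). \<forall>a b. f (Suc n) x = (a, b) \<longrightarrow> f n (d n x) = (b, \<one>\<^bsub>G\<^esub>))"
proof -
  interpret filtered_comm_group G A by fact
  let ?f = "\<lambda>n \<eta>. (point_value \<eta> {..n}, point_value \<eta> {1..n})"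
  \<comment> \<open>The zeroth coface acts as the successor, so the first coordinate of
    \<open>d n x\<close> is the second coordinate of \<open>x\<close>.\<close>
  have shift: "point_value (d n x) {..n} = point_value x {1..Suc n}" for n x
  proof -
    have "Suc ` {..n} = {1..Suc n}" by (simp add: image_Suc_atMost)
    then show ?thesis by (simp add: d_def point_value_moore_diff Sub_def)
  qed
  \<comment> \<open>The successor image of \<open>{1..n}\<close> misses \<open>1\<close>, so the
    Moore condition on \<open>x\<close> makes the value trivial; \<open>1 \<le> n\<close> keeps the
    set nonempty.\<close>
  have zero: "point_value (d n x) {1..n} = \<one>\<^bsub>G\<^esub>" if n: "1 \<le> n" and x: "x \<in> carrier (N (Suc n))" for n x
  proof -
    have "point_value (d n x) {1..n} = point_value x {2..Suc n}"
      using n by (simp add: d_def point_value_moore_diff Sub_def numeral_2_eq_2)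
    also have "\<dots> = \<one>\<^bsub>G\<^esub>"
    proof -
      have "{2..Suc n} \<in> Sub (Suc n)" "1 \<in> {1..Suc n}" "1 \<notin> {2..Suc n}"
        using n by (auto simp: Sub_def)
      then show ?thesis using x unfolding N_def moore_carrier by fastforce
    qed
    finally show ?thesis .
  qed
  show ?thesis
  proof (intro exI conjI)
    show "(\<lambda>\<eta>. point_value \<eta> {..0}) \<in> iso (N 0) (GA 0)"
      unfolding N_def GA_def by (rule moore_iso_0)
    show "\<forall>n\<ge>1. ?f n \<in> iso (N n) (GA n \<times>\<times> GA n)"
      unfolding N_def GA_def using moore_iso_pos by simp
    show "\<forall>x \<in> carrier (N 1). \<forall>a b. ?f 1 x = (a, b) \<longrightarrow> point_value (d 0 x) {..0} = b"
      by (simp only: shift) simp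
    show "\<forall>n\<ge>1. \<forall>x \<in> carrier (N (Suc n)). \<forall>a b.
        ?f (Suc n) x = (a, b) \<longrightarrow> ?f n (d n x) = (b, \<one>\<^bsub>G\<^esub>)"
      using shift zero by simp
  qed
qed

end
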